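(* Let $F(x)=\mathbb{E}_\xi[f(x;\xi)]$ on $\mathbb{R}^n$ be bounded below, $(L_0,L_1)$-smooth, with unbiased and $(G_0,G_1)$-variance-bounded stochastic gradients. Let $\rho>0$ and run the trust region method described in the context with $B_t=\rho I$ for all $t$. Then the solution of the subproblem is $$d_{t+1}=\min\left\{\frac{\Delta_t}{\|g_t\|},\frac1\rho\right\}\cdot(-g_t).$$ If moreover $0<\epsilon\leq \min\left\{\frac{4L_0G_0+16\rho G_0}{L_1G_0+2L_0G_1+8\rho G_1},\ \frac{4L_0+16\rho}{L_1}\right\}$, $\Delta_t=\Delta=(4L_0+16\rho)^{-1}\epsilon$ for all $t$, $|\mathcal S_1|=64G_0^2\epsilon^{-2}$, and $T = 32\Delta_F (L_0+4\rho)\epsilon^{-2}$, then $$\mathbb{E}\|\nabla F(x_{\bar t})\| \leq \epsilon,$$ where $\bar t$ is sampled uniformly at random from $\{0,1,\ldots,T-1\}$ (independently of everything else). Moreover, the total number $T|\mathcal S_1|$ of stochastic gradient samples used is $\mathcal O(\Delta_F (L_0+\rho) G_0^2\,\epsilon^{-4})$ (as $\epsilon\to0^+$, with an absolute constant).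
   Context: Norms are Euclidean for vectors and spectral for matrices. $F^*:=\inf_x F(x)>-\infty$ and $\Delta_F:=F(x_0)-F^*$, assumed positive, where $x_0$ is the deterministic starting point. Fractions with zero denominator are read as $+\infty$; $|\mathcal S_1|$ and $T$ are rounded up to integers. $(L_0,L_1)$-smoothness: $F$ is differentiable and there are constants $L_0>0$, $L_1\ge 0$ such that $\|x-x'\|\le 1/L_1$ implies $\|\nabla F(x)-\nabla F(x')\|\le (L_0+L_1\|\nabla F(x)\|)\|x-x'\|$. Unbiased and $(G_0,G_1)$-variance-bounded gradients ($G_0>0$, $G_1\ge0$): $\mathbb{E}_\xi[\nabla f(x;\xi)]=\nabla F(x)$ and $\mathbb{E}_\xi\|\nabla f(x;\xi)-\nabla F(x)\|^2\le G_0^2+G_1^2\|\nabla F(x)\|^2$ for all $x$. Trust region method: for $t=0,1,\dots,T-1$, draw a fresh batch $\mathcal S_1$ of i.i.d. samples of $\xi$ (independent of the past), set $g_t=\frac1{|\mathcal S_1|}\sum_{\xi\in\mathcal S_1}\nabla f(x_t;\xi)$, let $d_{t+1}$ be a global solution of the subproblem $$\min_{d\in\mathbb{R}^n}\ m_t(d):=F(x_t)+g_t^Td+\tfrac12 d^TB_td\quad\text{s.t. } \|d\|\le\Delta_t$$ (with $\Delta_t>0$), and set $x_{t+1}=x_t+d_{t+1}$. *)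

theory Defs
  imports "HOL-Probability.Probability"
begin

text \<open>
  Quotients whose denominator may vanish are formed in \<^typ>\<open>ereal\<close>, where \<^term>\<open>inverse (0::ereal)\<close>
  is \<^term>\<open>\<infinity> :: ereal\<close>; hence a positive numerator over zero is \<^term>\<open>\<infinity> :: ereal\<close>.
\<close>

definition gradient :: "(real ^ 'n \<Rightarrow> real) \<Rightarrow> real ^ 'n \<Rightarrow> real ^ 'n" where
  "gradient h x = (THE v. GDERIV h x :> v)"

definition L0L1_smooth :: "(real ^ 'n \<Rightarrow> real) \<Rightarrow> real \<Rightarrow> real \<Rightarrow> bool" where
  "L0L1_smooth F L0 L1 \<longleftrightarrow>
     L0 > 0 \<and> L1 \<ge> 0 \<and>
     (\<forall>x. F differentiable (at x)) \<and>
     (\<forall>x x'. ereal (norm (x - x')) \<le> 1 / ereal L1 \<longrightarrow>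
        norm (gradient F x - gradient F x') \<le> (L0 + L1 * norm (gradient F x)) * norm (x - x'))"

text \<open>
  Differentiability of \<open>y \<mapsto> f y \<xi>\<close> is what makes \<open>\<nabla>f(x;\<xi>)\<close> meaningful. Together with measurability
  of each \<open>f x\<close> (part of \<^const>\<open>has_bochner_integral\<close>) it entails joint measurability of \<open>f\<close> and of
  its gradient.
\<close>

definition stochastic_objective ::
  "'s measure \<Rightarrow> (real ^ 'n \<Rightarrow> 's \<Rightarrow> real) \<Rightarrow> (real ^ 'n \<Rightarrow> real) \<Rightarrow> bool" where
  "stochastic_objective D f F \<longleftrightarrow>
     prob_space D \<and>
     (\<forall>\<xi>\<in>space D. \<forall>x. (\<lambda>y. f y \<xi>) differentiable (at x)) \<and>
     (\<forall>x. has_bochner_integral D (f x) (F x))"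

definition unbiased_gradients ::
  "'s measure \<Rightarrow> (real ^ 'n \<Rightarrow> 's \<Rightarrow> real) \<Rightarrow> (real ^ 'n \<Rightarrow> real) \<Rightarrow> bool" where
  "unbiased_gradients D f F \<longleftrightarrow>
     (\<forall>x. has_bochner_integral D (\<lambda>\<xi>. gradient (\<lambda>y. f y \<xi>) x) (gradient F x))"

definition variance_bounded_gradients ::
  "'s measure \<Rightarrow> (real ^ 'n \<Rightarrow> 's \<Rightarrow> real) \<Rightarrow> (real ^ 'n \<Rightarrow> real) \<Rightarrow> real \<Rightarrow> real \<Rightarrow> bool" where
  "variance_bounded_gradients D f F G0 G1 \<longleftrightarrow>
     G0 > 0 \<and> G1 \<ge> 0 \<and>
     (\<forall>x. integrable D (\<lambda>\<xi>. (norm (gradient (\<lambda>y. f y \<xi>) x - gradient F x))\<^sup>2) \<and>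
          (\<integral>\<xi>. (norm (gradient (\<lambda>y. f y \<xi>) x - gradient F x))\<^sup>2 \<partial>D)
            \<le> G0\<^sup>2 + G1\<^sup>2 * (norm (gradient F x))\<^sup>2)"

definition tr_model :: "real \<Rightarrow> real ^ 'n \<Rightarrow> real ^ 'n ^ 'n \<Rightarrow> real ^ 'n \<Rightarrow> real" where
  "tr_model c g B d = c + g \<bullet> d + 1/2 * (d \<bullet> (B *v d))"

definition tr_solution :: "real \<Rightarrow> real ^ 'n \<Rightarrow> real ^ 'n ^ 'n \<Rightarrow> real \<Rightarrow> real ^ 'n \<Rightarrow> bool" where
  "tr_solution c g B \<Delta> d \<longleftrightarrow> is_arg_min (tr_model c g B) (\<lambda>v. norm v \<le> \<Delta>) d"

definition batch_gradient ::
  "(real ^ 'n \<Rightarrow> 's \<Rightarrow> real) \<Rightarrow> nat \<Rightarrow> (nat \<Rightarrow> 's) \<Rightarrow> real ^ 'n \<Rightarrow> real ^ 'n" where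
  "batch_gradient f b s x = (1 / real b) *\<^sub>R (\<Sum>i<b. gradient (\<lambda>y. f y (s i)) x)"

definition sample_indices :: "nat \<Rightarrow> nat \<Rightarrow> (nat \<times> nat) set" where
  "sample_indices T b = {..<T} \<times> {..<b}"

definition iid_samples ::
  "'w measure \<Rightarrow> 's measure \<Rightarrow> 'i set \<Rightarrow> ('i \<Rightarrow> 'w \<Rightarrow> 's) \<Rightarrow> bool" where
  "iid_samples M D I \<xi> \<longleftrightarrow>
     prob_space.indep_vars M (\<lambda>_. D) \<xi> I \<and> (\<forall>i\<in>I. distr M D (\<xi> i) = D)"

text \<open>
  \<open>\<xi> (t, i)\<close> is the \<open>i\<close>-th sample of the batch of size \<open>b\<close> drawn at iteration \<open>t\<close>. Since the starting
  point is deterministic, the past of iteration \<open>t\<close> consists of the earlier batches, so fresh i.i.d.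
  batches independent of the past amount to one i.i.d. family. \<open>B\<close> and \<open>\<Delta>\<close> are allowed to depend on
  the outcome \<open>\<omega>\<close>, as they do in adaptive variants.
\<close>

definition trust_region_run ::
  "'w measure \<Rightarrow> 's measure \<Rightarrow> (real ^ 'n \<Rightarrow> 's \<Rightarrow> real) \<Rightarrow> (real ^ 'n \<Rightarrow> real) \<Rightarrow>
   (nat \<Rightarrow> 'w \<Rightarrow> real ^ 'n ^ 'n) \<Rightarrow> (nat \<Rightarrow> 'w \<Rightarrow> real) \<Rightarrow> real ^ 'n \<Rightarrow> nat \<Rightarrow> nat \<Rightarrow>
   (nat \<times> nat \<Rightarrow> 'w \<Rightarrow> 's) \<Rightarrow> (nat \<Rightarrow> 'w \<Rightarrow> real ^ 'n) \<Rightarrow> (nat \<Rightarrow> 'w \<Rightarrow> real ^ 'n) \<Rightarrow>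
   (nat \<Rightarrow> 'w \<Rightarrow> real ^ 'n) \<Rightarrow> bool" where
  "trust_region_run M D f F B \<Delta> x0 T b \<xi> x g d \<longleftrightarrow>
     prob_space M \<and> b > 0 \<and>
     iid_samples M D (sample_indices T b) \<xi> \<and>
     (\<forall>\<omega>\<in>space M.
        x 0 \<omega> = x0 \<and>
        (\<forall>t<T. \<Delta> t \<omega> > 0 \<and>
           g t \<omega> = batch_gradient f b (\<lambda>i. \<xi> (t, i) \<omega>) (x t \<omega>) \<and>
           tr_solution (F (x t \<omega>)) (g t \<omega>) (B t \<omega>) (\<Delta> t \<omega>) (d (Suc t) \<omega>) \<and>
           x (Suc t) \<omega> = x t \<omega> + d (Suc t) \<omega>))"

text \<open>
  \<open>\<tau>\<close> is uniform on \<open>{0,\<dots>,T-1}\<close> and independent of the whole sample family jointly. The sigma-algebras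
  generated by the two variables are spelled out because \<^const>\<open>prob_space.indep_var\<close> needs equal
  codomain types.
\<close>

definition uniform_index ::
  "'w measure \<Rightarrow> 's measure \<Rightarrow> nat \<Rightarrow> nat \<Rightarrow> (nat \<times> nat \<Rightarrow> 'w \<Rightarrow> 's) \<Rightarrow> ('w \<Rightarrow> nat) \<Rightarrow> bool" where
  "uniform_index M D T b \<xi> \<tau> \<longleftrightarrow>
     \<tau> \<in> measurable M (count_space {..<T}) \<and>
     distr M (count_space {..<T}) \<tau> = uniform_count_measure {..<T} \<and>
     prob_space.indep_set M
       {\<tau> -` A \<inter> space M |A. A \<in> sets (count_space {..<T})}
       {(\<lambda>\<omega>. \<lambda>p\<in>sample_indices T b. \<xi> p \<omega>) -` A \<inter> space M
          |A. A \<in> sets (\<Pi>\<^sub>M p\<in>sample_indices T b. D)}"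

definition batch_size :: "real \<Rightarrow> real \<Rightarrow> nat" where
  "batch_size G0 \<epsilon> = nat \<lceil>64 * G0\<^sup>2 / \<epsilon>\<^sup>2\<rceil>"

definition num_iterations :: "real \<Rightarrow> real \<Rightarrow> real \<Rightarrow> real \<Rightarrow> nat" where
  "num_iterations \<Delta>F L0 \<rho> \<epsilon> = nat \<lceil>32 * \<Delta>F * (L0 + 4 * \<rho>) / \<epsilon>\<^sup>2\<rceil>"

end

theory Submission
  imports Defs
begin

text \<open>
  For \<open>B = \<rho> I\<close> the subproblem projects \<open>- g / \<rho>\<close> onto the ball. Comparing its solution with the point
  \<open>- (\<Delta> / \<parallel>g\<parallel>) g\<close> gives \<open>g \<bullet> d \<le> - \<Delta> \<parallel>g\<parallel> + \<rho> \<Delta>\<^sup>2 / 2\<close>, and \<open>(L\<^sub>0,L\<^sub>1)\<close>-smoothness turns this into a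
  decrease of \<open>F\<close> by \<open>\<Delta> \<parallel>\<nabla>F\<parallel>\<close> up to \<open>2 \<Delta> \<parallel>g - \<nabla>F\<parallel>\<close> and terms of order \<open>\<Delta>\<^sup>2\<close>. Since the fresh
  batch is independent of the iterate, the expected gradient error is at most
  \<open>(G\<^sub>0 + G\<^sub>1 E\<parallel>\<nabla>F\<parallel>) / \<surd>b\<close>; telescoping the expected decrease gives the rate.
\<close>

subsection \<open>The subproblem and the decrease of one step\<close>

text \<open>The gradient error enters twice: once when \<open>gradient F y\<close> is replaced by
  \<open>g\<close> in the linear term, once when \<open>norm g\<close> is replaced by
  \<open>norm (gradient F y)\<close>; hence the factor 2. With K = L0 + 4 rho the radius is epsilon
  / (4 K). The second bound on epsilon says precisely that this radius is at most 1 / L1, so that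
  smoothness applies to every step; the first keeps the terms proportional to the gradient norm at
  no more than half of the decrease. Much of the work is probabilistic. Gradients are evaluated at
  random points, so joint measurability in point and sample is required; it comes from difference
  quotients. Conditional expectations are avoided: every iterate is written as a measurable function
  of the tuple of earlier samples, and Tonelli on the product law replaces conditioning. The same
  representation makes the iterates independent of the output index. Integrability comes from the
  steps being bounded by the radius, which confines the iterates to deterministic balls.\<close>

definition tr_step :: "real \<Rightarrow> real \<Rightarrow> real ^ 'n \<Rightarrow> real ^ 'n" where
  "tr_step \<Delta> \<rho> g = real_of_ereal (min (ereal \<Delta> / ereal (norm g)) (ereal (1 / \<rho>))) *\<^sub>R (- g)"

text \<open>The case split asks whether the unconstrained minimiser \<open>- g / \<rho>\<close> lies
  in the ball. For \<open>g = 0\<close> the extended quotient is infinite, so the minimum is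
  \<open>1 / \<rho>\<close> and the first case is the right one.\<close>

lemma tr_step_eq:
  assumes "\<Delta> > 0" "\<rho> > 0"
  shows "tr_step \<Delta> \<rho> g = (if norm g \<le> \<rho> * \<Delta> then 1 / \<rho> else \<Delta> / norm g) *\<^sub>R (- g)"
proof (cases "g = 0")
  case False
  then have "norm g > 0" by simp
  then show ?thesis
    using assms unfolding tr_step_def
    by (auto simp: min_def field_simps)
qed (simp add: tr_step_def)

lemma norm_tr_step_le:
  assumes "\<Delta> > 0" "\<rho> > 0"
  shows "norm (tr_step \<Delta> \<rho> g) \<le> \<Delta>"
  using assms by (auto simp: tr_step_eq field_simps abs_if divide_nonneg_nonneg)

lemma borel_measurable_tr_step [measurable]: "tr_step \<Delta> \<rho> \<in> borel_measurable borel"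
  unfolding tr_step_def by measurable

lemma mat_mult_vec: "mat c *v v = c *\<^sub>R v"
proof -
  have "(mat c *v v) $ i = (\<Sum>j\<in>UNIV. (if i = j then c * v $ j else 0))" for i
    unfolding matrix_vector_mult_def mat_def vec_lambda_beta by (rule sum.cong) auto
  then show ?thesis by (simp add: vec_eq_iff)
qed

text \<open>Second-order Taylor expansion at \<open>s\<close>, exact because the model is quadratic
  with Hessian \<open>\<rho>\<close> times the identity.\<close>

lemma tr_model_scaled_identity:
  "tr_model c g (mat \<rho>) v =
     tr_model c g (mat \<rho>) s + (g + \<rho> *\<^sub>R s) \<bullet> (v - s) + \<rho> / 2 * (norm (v - s))\<^sup>2"
  by (simp add: tr_model_def mat_mult_vec power2_norm_eq_inner inner_diff inner_add inner_commute
      algebra_simps)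

text \<open>The step \<open>s\<close> projects \<open>- g / \<rho>\<close> onto the ball; the bound below is the variational inequality
  of this projection.\<close>

lemma tr_model_growth:
  fixes g v :: "real ^ 'n"
  assumes pos: "\<Delta> > 0" "\<rho> > 0" and v: "norm v \<le> \<Delta>"
  defines "s \<equiv> tr_step \<Delta> \<rho> g"
  shows "tr_model c g (mat \<rho>) v \<ge> tr_model c g (mat \<rho>) s + \<rho> / 2 * (norm (v - s))\<^sup>2"
proof -
  \<comment> \<open>First-order optimality at \<open>s\<close>. In the interior case the model
    gradient \<open>g + \<rho> *\<^sub>R s\<close> vanishes; otherwise it is a nonnegative multiple
    of \<open>g\<close>, and \<open>s\<close> minimises the linear form of \<open>g\<close> over the
    ball.\<close>
  have "(g + \<rho> *\<^sub>R s) \<bullet> (v - s) \<ge> 0"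
  proof (cases "norm g \<le> \<rho> * \<Delta>")
    case True
    then have "g + \<rho> *\<^sub>R s = 0" using pos by (simp add: s_def tr_step_eq)
    then show ?thesis by simp
  next
    case False
    have g: "norm g > 0" using False pos by (smt (verit) mult_pos_pos)
    have s: "s = - (\<Delta> / norm g) *\<^sub>R g" using False pos by (simp add: s_def tr_step_eq)
    have "\<bar>g \<bullet> v\<bar> \<le> norm g * \<Delta>"
      using Cauchy_Schwarz_ineq2[of g v] v g by (smt (verit) mult_left_mono)
    moreover have "(\<Delta> / norm g) * (g \<bullet> g) = \<Delta> * norm g"
      using g by (simp add: dot_square_norm power2_eq_square)
    ultimately have "g \<bullet> (v - s) \<ge> 0"
      by (simp add: s inner_diff_right inner_add_right algebra_simps)
    moreover have "1 - \<rho> * (\<Delta> / norm g) \<ge> 0" using False g by (simp add: field_simps)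
    moreover have "g + \<rho> *\<^sub>R s = (1 - \<rho> * (\<Delta> / norm g)) *\<^sub>R g"
      by (simp add: s scaleR_left_diff_distrib)
    ultimately show ?thesis by simp
  qed
  then show ?thesis using tr_model_scaled_identity[of c g \<rho> v s] by linarith
qed

text \<open>The quadratic growth term yields both minimality of the step and uniqueness: a competing
  minimiser has growth term at most zero, hence distance zero from the step.\<close>

lemma tr_solution_iff:
  assumes pos: "\<Delta> > 0" "\<rho> > 0"
  shows "tr_solution c g (mat \<rho>) \<Delta> v \<longleftrightarrow> v = tr_step \<Delta> \<rho> g"
proof
  assume v: "tr_solution c g (mat \<rho>) \<Delta> v"
  then have "norm v \<le> \<Delta>"
    and "tr_model c g (mat \<rho>) v \<le> tr_model c g (mat \<rho>) (tr_step \<Delta> \<rho> g)"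
    using norm_tr_step_le[OF pos, of g] by (auto simp: tr_solution_def is_arg_min_def not_less)
  then have "\<rho> / 2 * (norm (v - tr_step \<Delta> \<rho> g))\<^sup>2 \<le> 0"
    using tr_model_growth[OF pos, of v c g] by linarith
  then show "v = tr_step \<Delta> \<rho> g" using pos by (simp add: mult_le_0_iff)
next
  have "tr_model c g (mat \<rho>) (tr_step \<Delta> \<rho> g) \<le> tr_model c g (mat \<rho>) y" if "norm y \<le> \<Delta>" for y
    using tr_model_growth[OF pos that, of c g] pos
    by (smt (verit) divide_nonneg_nonneg mult_nonneg_nonneg zero_le_power2)
  then show "v = tr_step \<Delta> \<rho> g \<Longrightarrow> tr_solution c g (mat \<rho>) \<Delta> v"
    using norm_tr_step_le[OF pos] by (force simp: tr_solution_def is_arg_min_def)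
qed

lemma inner_tr_step_le:
  assumes pos: "\<Delta> > 0" "\<rho> > 0"
  shows "g \<bullet> tr_step \<Delta> \<rho> g \<le> - \<Delta> * norm g + \<rho> / 2 * \<Delta>\<^sup>2"
proof -
  define s where "s = tr_step \<Delta> \<rho> g"
  \<comment> \<open>The boundary point in the direction of steepest descent. For
    \<open>g = 0\<close> division by zero makes \<open>u = 0\<close>, and the two facts used,
    \<open>norm u \<le> \<Delta>\<close> and \<open>g \<bullet> u = - \<Delta> * norm g\<close>,
    still hold.\<close>
  define u where "u = - (\<Delta> / norm g) *\<^sub>R g"
  have u: "norm u \<le> \<Delta>" using pos by (simp add: u_def)
  have "tr_model 0 g (mat \<rho>) s \<le> tr_model 0 g (mat \<rho>) u"
    using tr_model_growth[OF pos u, of 0 g] pos s_def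
    by (smt (verit) divide_nonneg_nonneg mult_nonneg_nonneg zero_le_power2)
  moreover have "tr_model 0 g (mat \<rho>) u \<le> - \<Delta> * norm g + \<rho> / 2 * \<Delta>\<^sup>2"
  proof -
    have "g \<bullet> u = - \<Delta> * norm g"
      by (simp add: u_def dot_square_norm power2_eq_square)
    moreover have "u \<bullet> u \<le> \<Delta>\<^sup>2"
      using u pos by (simp add: dot_square_norm power_mono)
    then have "\<rho> / 2 * (u \<bullet> u) \<le> \<rho> / 2 * \<Delta>\<^sup>2" using pos by (intro mult_left_mono) auto
    ultimately show ?thesis by (simp add: tr_model_def mat_mult_vec)
  qed
  moreover have "g \<bullet> s \<le> tr_model 0 g (mat \<rho>) s"
    using pos by (simp add: tr_model_def mat_mult_vec)
  ultimately show ?thesis by (simp add: s_def)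
qed

section \<open>Gradients along lines and descent under generalized smoothness\<close>

lemma gradient_eqI:
  assumes "GDERIV h x :> v"
  shows "gradient h x = v"
  unfolding gradient_def
proof (rule the_equality[of "\<lambda>v. GDERIV h x :> v", OF assms])
  fix w assume "GDERIV h x :> w"
  then have "(\<lambda>y. y \<bullet> w) = (\<lambda>y. y \<bullet> v)"
    using assms has_derivative_unique by (auto simp: gderiv_def)
  then have "y \<bullet> w = y \<bullet> v" for y by metis
  then show "w = v" using vector_eq_ldot by blast
qed

lemma GDERIV_gradient:
  assumes "h differentiable (at x)"
  shows "GDERIV h x :> gradient h x"
proof -
  obtain L where L: "(h has_derivative L) (at x)"
    using assms by (auto simp: differentiable_def)
  then interpret bounded_linear L by (rule has_derivative_bounded_linear)
  \<comment> \<open>Riesz representation of the derivative: the representing vector collects its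
    values on the axis vectors.\<close>
  have "L = (\<lambda>y. y \<bullet> (\<chi> i. L (axis i 1)))"
  proof
    fix y
    have "L y = L (\<Sum>i\<in>UNIV. (y $ i) *\<^sub>R axis i 1)"
      by (simp flip: scalar_mult_eq_scaleR add: basis_expansion)
    also have "\<dots> = y \<bullet> (\<chi> i. L (axis i 1))"
      by (simp add: sum scaleR inner_vec_def)
    finally show "L y = y \<bullet> (\<chi> i. L (axis i 1))" .
  qed
  then have "GDERIV h x :> (\<chi> i. L (axis i 1))" using L by (simp add: gderiv_def)
  from this gradient_eqI[OF this] show ?thesis by simp
qed

lemma DERIV_along_line:
  assumes "\<And>x. h differentiable (at x)"
  shows "((\<lambda>s. h (x + s *\<^sub>R v)) has_real_derivative gradient h (x + s *\<^sub>R v) \<bullet> v) (at s)"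
proof -
  have "((\<lambda>s. h (x + s *\<^sub>R v)) has_derivative (\<lambda>t. (t *\<^sub>R v) \<bullet> gradient h (x + s *\<^sub>R v))) (at s)"
    using GDERIV_gradient[OF assms]
    by (intro has_derivative_compose[where g = h and f = "\<lambda>s. x + s *\<^sub>R v"])
       (auto simp: gderiv_def intro!: derivative_eq_intros)
  then show ?thesis
    by (simp add: has_field_derivative_def mult.commute inner_commute[of _ v] mult_commute_abs)
qed

text \<open>Integration of the gradient is avoided: \<open>\<phi>\<close> is \<open>F\<close> along
  the segment minus its linear and quadratic terms, and the smoothness bound makes its derivative
  nonpositive on [0, 1].\<close>

lemma L0L1_descent:
  assumes smooth: "L0L1_smooth F L0 L1" and r: "ereal (norm v) \<le> 1 / ereal L1"
  shows "F (x + v) \<le> F x + gradient F x \<bullet> v + (L0 + L1 * norm (gradient F x)) / 2 * (norm v)\<^sup>2"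
proof -
  define K where "K = L0 + L1 * norm (gradient F x)"
  define \<phi> where "\<phi> = (\<lambda>s. F (x + s *\<^sub>R v) - s * (gradient F x \<bullet> v) - K * s\<^sup>2 / 2 * (norm v)\<^sup>2)"
  have diff: "F differentiable (at y)" for y
    using smooth by (auto simp: L0L1_smooth_def)
  have "\<phi> 1 \<le> \<phi> 0"
  proof (rule DERIV_nonpos_imp_nonincreasing[where f = \<phi>])
    fix s :: real assume s: "0 \<le> s" "s \<le> 1"
    let ?d = "gradient F (x + s *\<^sub>R v) \<bullet> v - gradient F x \<bullet> v - K * s * (norm v)\<^sup>2"
    have "(\<phi> has_real_derivative ?d) (at s)"
      unfolding \<phi>_def
      by (rule derivative_eq_intros DERIV_along_line[OF diff] refl | simp)+
    moreover have "?d \<le> 0"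
    proof -
      have "norm (s *\<^sub>R v) \<le> norm v" using s by (simp add: mult_left_le_one_le)
      then have "ereal (norm (x - (x + s *\<^sub>R v))) \<le> 1 / ereal L1"
        using r by (simp add: order_trans[OF _ r] del: norm_scaleR)
      \<comment> \<open>Smoothness is always based at \<open>x\<close>, so \<open>K\<close> is the
        same for every \<open>s\<close>.\<close>
      then have "norm (gradient F x - gradient F (x + s *\<^sub>R v)) \<le> K * norm (x - (x + s *\<^sub>R v))"
        using smooth unfolding L0L1_smooth_def K_def by blast
      then have "norm (gradient F (x + s *\<^sub>R v) - gradient F x) \<le> K * (s * norm v)"
        using s by (simp add: norm_minus_commute)
      then have "norm (gradient F (x + s *\<^sub>R v) - gradient F x) * norm v \<le> K * (s * norm v) * norm v"
        by (intro mult_right_mono) auto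
      then have "(gradient F (x + s *\<^sub>R v) - gradient F x) \<bullet> v \<le> K * s * (norm v)\<^sup>2"
        using norm_cauchy_schwarz[of "gradient F (x + s *\<^sub>R v) - gradient F x" v]
        by (simp add: power2_eq_square mult.assoc)
      then show ?thesis by (simp add: inner_diff_left)
    qed
    ultimately show "\<exists>y. (\<phi> has_real_derivative y) (at s) \<and> y \<le> 0" by blast
  qed simp
  then show ?thesis by (simp add: \<phi>_def K_def)
qed

text \<open>Near a fixed \<open>x\<close> the increment of the gradient is at most a constant times
  the distance. Continuity serves twice later: for Borel measurability of \<open>gradient F\<close>
  and for its boundedness on balls.\<close>

lemma L0L1_gradient_continuous:
  assumes smooth: "L0L1_smooth F L0 L1"
  shows "continuous_on UNIV (gradient F)"
proof -
  have "isCont (gradient F) x" for x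
  proof -
    define K where "K = L0 + L1 * norm (gradient F x)"
    obtain r :: real where r: "r > 0" "ereal r \<le> 1 / ereal L1"
    proof (cases "L1 = 0")
      case True then show ?thesis using that[of 1] by (simp add: divide_ereal_def)
    next
      case False then show ?thesis using that[of "1 / L1"] smooth
        by (auto simp: L0L1_smooth_def divide_ereal_def divide_inverse)
    qed
    have ev: "\<forall>\<^sub>F y in at x. norm (gradient F y - gradient F x) \<le> K * norm (x - y)"
      unfolding eventually_at
    proof (intro exI[of _ r] conjI ballI impI)
      fix y assume "y \<noteq> x \<and> dist y x < r"
      then have "ereal (norm (x - y)) \<le> 1 / ereal L1"
        using r(2) by (auto simp: dist_norm norm_minus_commute intro: order_trans[OF _ r(2)])
      then show "norm (gradient F y - gradient F x) \<le> K * norm (x - y)"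
        using smooth unfolding L0L1_smooth_def K_def by (metis norm_minus_commute)
    qed (use r in auto)
    have "((\<lambda>y. K * norm (x - y)) \<longlongrightarrow> K * norm (x - x)) (at x)"
      by (intro tendsto_intros)
    then have "((\<lambda>y. gradient F y - gradient F x) \<longlongrightarrow> 0) (at x)"
      by (intro Lim_null_comparison[OF ev]) simp
    then show ?thesis by (simp add: isCont_def LIM_zero_cancel)
  qed
  then show ?thesis by (simp add: continuous_on_eq_continuous_at)
qed

text \<open>The descent inequality at \<open>y\<close>, with \<open>gradient F y\<close> traded for
  \<open>g\<close> at a cost of \<open>\<Delta> * norm e\<close>, and \<open>norm g\<close> traded
  back at the same cost.\<close>

lemma tr_step_decrease:
  assumes smooth: "L0L1_smooth F L0 L1" and pos: "\<Delta> > 0" "\<rho> > 0"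
    and r: "ereal \<Delta> \<le> 1 / ereal L1"
  shows "F (y + tr_step \<Delta> \<rho> g) \<le> F y - \<Delta> * norm (gradient F y) + 2 * \<Delta> * norm (g - gradient F y)
     + (L0 + \<rho> + L1 * norm (gradient F y)) / 2 * \<Delta>\<^sup>2"
proof -
  define s where "s = tr_step \<Delta> \<rho> g"
  define e where "e = g - gradient F y"
  have L: "L0 > 0" "L1 \<ge> 0" using smooth by (auto simp: L0L1_smooth_def)
  have s: "norm s \<le> \<Delta>" using norm_tr_step_le[OF pos] s_def by simp
  have "F (y + s) \<le> F y + gradient F y \<bullet> s + (L0 + L1 * norm (gradient F y)) / 2 * (norm s)\<^sup>2"
    using s r by (intro L0L1_descent[OF smooth]) (auto intro: order_trans[OF _ r])
  also have "gradient F y \<bullet> s = g \<bullet> s - e \<bullet> s" by (simp add: e_def inner_diff_left)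
  finally have "F (y + s) \<le> F y + g \<bullet> s - e \<bullet> s + (L0 + L1 * norm (gradient F y)) / 2 * (norm s)\<^sup>2"
    by simp
  moreover have "(L0 + L1 * norm (gradient F y)) / 2 * (norm s)\<^sup>2
      \<le> (L0 + L1 * norm (gradient F y)) / 2 * \<Delta>\<^sup>2"
    using L s by (intro mult_left_mono power_mono) auto
  moreover have "- (e \<bullet> s) \<le> \<Delta> * norm e"
    using Cauchy_Schwarz_ineq2[of e s] s mult_left_mono[OF s, of "norm e"] by (simp add: mult.commute)
  moreover have "g \<bullet> s \<le> - \<Delta> * norm g + \<rho> / 2 * \<Delta>\<^sup>2"
    using inner_tr_step_le[OF pos] s_def by simp
  moreover have "\<Delta> * norm g \<ge> \<Delta> * (norm (gradient F y) - norm e)"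
    using pos norm_triangle_sub[of "gradient F y" g]
    by (intro mult_left_mono) (auto simp: e_def norm_minus_commute)
  ultimately show ?thesis by (simp add: s_def e_def algebra_simps add_divide_distrib)
qed

subsection \<open>Joint measurability of stochastic gradients\<close>

text \<open>Rounding the first argument to a grid reduces the claim to countably many sections.\<close>

lemma caratheodory_measurable:
  fixes h :: "real ^ 'n \<Rightarrow> 's \<Rightarrow> real"
  assumes meas: "\<And>x. h x \<in> borel_measurable D"
    and cont: "\<And>\<xi>. \<xi> \<in> space D \<Longrightarrow> continuous_on UNIV (\<lambda>x. h x \<xi>)"
  shows "(\<lambda>(x, \<xi>). h x \<xi>) \<in> borel_measurable (borel \<Otimes>\<^sub>M D)"
proof -
  \<comment> \<open>Rounding is split into an integer label \<open>q n x\<close> and a grid point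
    \<open>p n k\<close> of mesh \<open>1 / Suc n\<close>. Labels form a countable type, so
    measurability can be checked for each fixed label, where a single section of \<open>h\<close>
    remains.\<close>
  define q where "q n x = (\<chi> i. \<lfloor>real (Suc n) * x $ i\<rfloor>)" for n and x :: "real ^ 'n"
  define p where "p n k = (\<chi> i. real_of_int (k $ i) / real (Suc n))" for n and k :: "int ^ 'n"
  have q: "q n \<in> borel \<rightarrow>\<^sub>M count_space UNIV" for n
  proof -
    have "q n -` {k} = (\<Inter>i\<in>UNIV. {x. \<lfloor>real (Suc n) * x $ i\<rfloor> = k $ i})" for k
      by (auto simp: q_def vec_eq_iff)
    moreover have "{x :: real ^ 'n. \<lfloor>real (Suc n) * x $ i\<rfloor> = k $ i} \<in> sets borel" for k :: "int ^ 'n" and i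
    proof -
      have "(\<lambda>x :: real ^ 'n. real (Suc n) * x $ i) \<in> borel_measurable borel"
        by (intro borel_measurable_continuous_onI continuous_intros)
      then show ?thesis by measurable
    qed
    ultimately show ?thesis
      by (subst measurable_count_space_eq2_countable) (auto intro!: sets.finite_INT)
  qed
  have p_q: "(\<lambda>n. p n (q n x)) \<longlonglongrightarrow> x" for x
  proof (rule vec_tendstoI)
    fix i
    have "\<bar>p n (q n x) $ i - x $ i\<bar> \<le> inverse (real (Suc n))" for n
    proof -
      have "p n (q n x) $ i - x $ i = (\<lfloor>real (Suc n) * x $ i\<rfloor> - real (Suc n) * x $ i) / real (Suc n)"
        by (simp add: p_def q_def diff_divide_distrib)
      also have "\<bar>\<dots>\<bar> \<le> 1 / real (Suc n)"
        unfolding abs_divide abs_of_nat by (intro divide_right_mono) linarith+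
      finally show ?thesis by (simp add: inverse_eq_divide)
    qed
    then have "(\<lambda>n. p n (q n x) $ i - x $ i) \<longlonglongrightarrow> 0"
      by (intro Lim_null_comparison[OF _ LIMSEQ_inverse_real_of_nat]) auto
    then show "(\<lambda>n. p n (q n x) $ i) \<longlonglongrightarrow> x $ i" by (rule LIM_zero_cancel)
  qed
  show ?thesis
  proof (rule borel_measurable_LIMSEQ_real)
    fix n
    have "(\<lambda>z. h (p n (q n (fst z))) (snd z)) \<in> borel_measurable (borel \<Otimes>\<^sub>M D)"
      by (rule measurable_compose_countable[where f = "\<lambda>k z. h (p n k) (snd z)" and g = "\<lambda>z. q n (fst z)"])
         (auto intro: measurable_compose[OF measurable_snd meas] measurable_compose[OF measurable_fst q])
    then show "(\<lambda>z. h (p n (q n (fst z))) (snd z)) \<in> borel_measurable (borel \<Otimes>\<^sub>M D)" .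
  next
    fix z :: "(real ^ 'n) \<times> 's" assume z: "z \<in> space (borel \<Otimes>\<^sub>M D)"
    then have "isCont (\<lambda>x. h x (snd z)) (fst z)"
      using cont by (auto simp: space_pair_measure continuous_on_eq_continuous_at)
    then show "(\<lambda>n. h (p n (q n (fst z))) (snd z)) \<longlonglongrightarrow> (case z of (x, \<xi>) \<Rightarrow> h x \<xi>)"
      using isCont_tendsto_compose[OF _ p_q] by (simp add: case_prod_beta)
  qed
qed

text \<open>A partial derivative as a limit along a sequence, the form in which limits preserve
  measurability.\<close>

lemma gradient_component_LIMSEQ:
  assumes diff: "\<And>x. h differentiable (at x)"
  shows "(\<lambda>n. (h (x + inverse (real (Suc n)) *\<^sub>R axis i 1) - h x) * real (Suc n)) \<longlonglongrightarrow> gradient h x $ i"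
proof -
  have "((\<lambda>s. h (x + s *\<^sub>R axis i 1)) has_real_derivative gradient h x $ i) (at 0)"
    using DERIV_along_line[OF diff, of x "axis i 1" 0] by (simp add: inner_axis)
  then have "((\<lambda>s. (h (x + s *\<^sub>R axis i 1) - h x) / s) \<longlongrightarrow> gradient h x $ i) (at 0)"
    by (simp add: DERIV_def)
  moreover have "filterlim (\<lambda>n. inverse (real (Suc n))) (at 0) sequentially"
    using LIMSEQ_inverse_real_of_nat by (simp add: filterlim_at)
  ultimately have "(\<lambda>n. (h (x + inverse (real (Suc n)) *\<^sub>R axis i 1) - h x) / inverse (real (Suc n)))
      \<longlonglongrightarrow> gradient h x $ i"
    by (rule filterlim_compose)
  then show ?thesis by (simp add: divide_inverse)
qed

lemma borel_measurable_vecI: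
  fixes h :: "'a \<Rightarrow> real ^ 'n"
  assumes "\<And>i. (\<lambda>z. h z $ i) \<in> borel_measurable M"
  shows "h \<in> borel_measurable M"
  unfolding borel_measurable_euclidean_space[of h] using assms
  by (auto simp: Basis_vec_def inner_axis)

text \<open>Each component is a pointwise limit of difference quotients of \<open>f\<close>, which
  is jointly measurable because it is continuous in the point. Joint measurability allows evaluation
  at a random iterate.\<close>

lemma gradient_joint_measurable:
  fixes f :: "real ^ 'n \<Rightarrow> 's \<Rightarrow> real"
  assumes obj: "stochastic_objective D f F"
  shows "(\<lambda>z. gradient (\<lambda>y. f y (snd z)) (fst z)) \<in> borel_measurable (borel \<Otimes>\<^sub>M D)"
proof (rule borel_measurable_vecI)
  fix i
  have diff: "(\<lambda>y. f y \<xi>) differentiable (at x)" if "\<xi> \<in> space D" for \<xi> x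
    using obj that by (auto simp: stochastic_objective_def)
  have meas: "f x \<in> borel_measurable D" for x
    using obj by (auto simp: stochastic_objective_def has_bochner_integral_iff)
  have "(\<lambda>(x, \<xi>). f x \<xi>) \<in> borel_measurable (borel \<Otimes>\<^sub>M D)"
    using diff by (intro caratheodory_measurable meas)
      (auto simp: continuous_on_eq_continuous_at intro: differentiable_imp_continuous_within)
  from measurable_compose[OF _ this, of "\<lambda>z. (fst z + v, snd z)" "borel \<Otimes>\<^sub>M D" for v]
  have shift: "(\<lambda>z. f (fst z + v) (snd z)) \<in> borel_measurable (borel \<Otimes>\<^sub>M D)" for v
    by simp
  show "(\<lambda>z. gradient (\<lambda>y. f y (snd z)) (fst z) $ i) \<in> borel_measurable (borel \<Otimes>\<^sub>M D)"
  proof (rule borel_measurable_LIMSEQ_real)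
    fix n
    show "(\<lambda>z. (f (fst z + inverse (real (Suc n)) *\<^sub>R axis i 1) (snd z) - f (fst z) (snd z)) * real (Suc n))
        \<in> borel_measurable (borel \<Otimes>\<^sub>M D)"
      using shift shift[of 0] by (intro borel_measurable_times borel_measurable_diff) auto
  next
    fix z :: "(real ^ 'n) \<times> 's" assume "z \<in> space (borel \<Otimes>\<^sub>M D) "
    then show "(\<lambda>n. (f (fst z + inverse (real (Suc n)) *\<^sub>R axis i 1) (snd z) - f (fst z) (snd z)) * real (Suc n))
        \<longlonglongrightarrow> gradient (\<lambda>y. f y (snd z)) (fst z) $ i"
      by (intro gradient_component_LIMSEQ diff) (auto simp: space_pair_measure)
  qed
qed

subsection \<open>Deviation of batch means and independence\<close>

context prob_space
begin

text \<open>Nonnegativity of the variance. Independence controls second moments, whereas the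
  decrease involves the first moment of the error.\<close>

lemma expectation_le_sqrt_second_moment:
  fixes X :: "'a \<Rightarrow> real"
  assumes [measurable]: "random_variable borel X" and sq: "integrable M (\<lambda>\<omega>. (X \<omega>)\<^sup>2)"
  shows "integrable M X" "expectation X \<le> sqrt (expectation (\<lambda>\<omega>. (X \<omega>)\<^sup>2))"
proof -
  show int: "integrable M X"
    using square_integrable_imp_integrable[OF _ sq] by simp
  have "(expectation X)\<^sup>2 \<le> expectation (\<lambda>\<omega>. (X \<omega>)\<^sup>2)"
    using variance_positive[of X] variance_eq[OF int sq] by simp
  then show "expectation X \<le> sqrt (expectation (\<lambda>\<omega>. (X \<omega>)\<^sup>2))"
    by (rule real_le_rsqrt)
qed

text \<open>The inner product is expanded over the basis, since expectations of products factor for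
  scalar variables.\<close>

lemma indep_vars_inner_uncorrelated:
  fixes W :: "'i \<Rightarrow> 'a \<Rightarrow> 'b :: euclidean_space"
  assumes ind: "indep_vars (\<lambda>_. borel) W I" and ij: "i \<in> I" "j \<in> I" "i \<noteq> j"
    and int: "integrable M (W i)" "integrable M (W j)" and mean: "expectation (W i) = 0"
  shows "integrable M (\<lambda>\<omega>. W i \<omega> \<bullet> W j \<omega>)" "expectation (\<lambda>\<omega>. W i \<omega> \<bullet> W j \<omega>) = 0"
proof -
  have comp: "integrable M (\<lambda>\<omega>. (W i \<omega> \<bullet> c) * (W j \<omega> \<bullet> c))"
    "expectation (\<lambda>\<omega>. (W i \<omega> \<bullet> c) * (W j \<omega> \<bullet> c)) = 0" for c
  proof -
    \<comment> \<open>Independence of the pair is read off the family through the disjoint index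
      sets \<open>{i}\<close> and \<open>{j}\<close>.\<close>
    have "indep_var borel ((\<lambda>s. s i \<bullet> c) \<circ> (\<lambda>\<omega>. \<lambda>k\<in>{i}. W k \<omega>)) borel ((\<lambda>s. s j \<bullet> c) \<circ> (\<lambda>\<omega>. \<lambda>k\<in>{j}. W k \<omega>))"
      using ij by (intro indep_var_compose[OF indep_var_restrict[OF ind]]) (auto intro!: borel_measurable_inner)
    then have iv: "indep_var borel (\<lambda>\<omega>. W i \<omega> \<bullet> c) borel (\<lambda>\<omega>. W j \<omega> \<bullet> c)"
      by (simp add: o_def)
    show "integrable M (\<lambda>\<omega>. (W i \<omega> \<bullet> c) * (W j \<omega> \<bullet> c))"
      by (rule indep_var_integrable[OF iv]) (use int in auto)
    show "expectation (\<lambda>\<omega>. (W i \<omega> \<bullet> c) * (W j \<omega> \<bullet> c)) = 0"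
      by (subst indep_var_lebesgue_integral[OF iv]) (use int mean in auto)
  qed
  have expand: "W i \<omega> \<bullet> W j \<omega> = (\<Sum>c\<in>Basis. (W i \<omega> \<bullet> c) * (W j \<omega> \<bullet> c))" for \<omega>
    by (rule euclidean_inner)
  show "integrable M (\<lambda>\<omega>. W i \<omega> \<bullet> W j \<omega>)" "expectation (\<lambda>\<omega>. W i \<omega> \<bullet> W j \<omega>) = 0"
    unfolding expand using comp by auto
qed

text \<open>Expanding the squared norm of the centred sum, the cross terms have mean zero and the
  diagonal contributes at most \<open>V\<close> per sample.\<close>

lemma sample_mean_deviation:
  fixes Z :: "'i \<Rightarrow> 'a \<Rightarrow> 'b :: euclidean_space"
  assumes I: "finite I" "I \<noteq> {}" and ind: "indep_vars (\<lambda>_. borel) Z I"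
    and int: "\<And>i. i \<in> I \<Longrightarrow> integrable M (Z i)" and mean: "\<And>i. i \<in> I \<Longrightarrow> expectation (Z i) = \<mu>"
    and sq: "\<And>i. i \<in> I \<Longrightarrow> integrable M (\<lambda>\<omega>. (norm (Z i \<omega> - \<mu>))\<^sup>2)"
    and var: "\<And>i. i \<in> I \<Longrightarrow> expectation (\<lambda>\<omega>. (norm (Z i \<omega> - \<mu>))\<^sup>2) \<le> V"
  defines "A \<equiv> \<lambda>\<omega>. (1 / real (card I)) *\<^sub>R (\<Sum>i\<in>I. Z i \<omega>)"
  shows "integrable M (\<lambda>\<omega>. norm (A \<omega> - \<mu>))"
    "expectation (\<lambda>\<omega>. norm (A \<omega> - \<mu>)) \<le> sqrt (V / real (card I))"
proof -
  define n where "n = real (card I)"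
  define W where "W i \<omega> = Z i \<omega> - \<mu>" for i \<omega>
  have n: "n > 0" using I by (simp add: n_def card_gt_0_iff)
  have W_ind: "indep_vars (\<lambda>_. borel) W I"
    unfolding W_def by (rule indep_vars_compose2[OF ind]) auto
  have W_int: "integrable M (W i)" "expectation (W i) = 0" if "i \<in> I" for i
    using int[OF that] mean[OF that] by (auto simp: W_def[abs_def] prob_space)
  have prods: "integrable M (\<lambda>\<omega>. W i \<omega> \<bullet> W j \<omega>)"
    "expectation (\<lambda>\<omega>. W i \<omega> \<bullet> W j \<omega>) \<le> (if i = j then V else 0)" if "i \<in> I" "j \<in> I" for i j
    using that indep_vars_inner_uncorrelated[OF W_ind that _ W_int(1)[OF that(1)] W_int(1)[OF that(2)] W_int(2)[OF that(1)]]
      sq[OF that(1)] var[OF that(1)]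
    by (auto simp: W_def power2_norm_eq_inner)
  have norm_eq: "norm (A \<omega> - \<mu>) = norm (\<Sum>i\<in>I. W i \<omega>) / n" for \<omega>
  proof -
    have "A \<omega> - \<mu> = (1 / n) *\<^sub>R (\<Sum>i\<in>I. W i \<omega>)"
      using n by (simp add: W_def A_def sum_subtractf scaleR_diff_right n_def sum_constant_scaleR)
    then show ?thesis using n by simp
  qed
  have sq_eq: "(norm (A \<omega> - \<mu>))\<^sup>2 = (\<Sum>i\<in>I. \<Sum>j\<in>I. W i \<omega> \<bullet> W j \<omega>) / n\<^sup>2" for \<omega>
    unfolding norm_eq power_divide power2_norm_eq_inner inner_sum_left
    unfolding inner_sum_right by (rule refl)
  have A_sq: "integrable M (\<lambda>\<omega>. (norm (A \<omega> - \<mu>))\<^sup>2)"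
    unfolding sq_eq using prods(1) by auto
  have "expectation (\<lambda>\<omega>. (norm (A \<omega> - \<mu>))\<^sup>2) = (\<Sum>i\<in>I. \<Sum>j\<in>I. expectation (\<lambda>\<omega>. W i \<omega> \<bullet> W j \<omega>)) / n\<^sup>2"
    unfolding sq_eq using prods(1) by (simp add: Bochner_Integration.integral_sum)
  also have "\<dots> \<le> (\<Sum>i\<in>I. \<Sum>j\<in>I. if i = j then V else 0) / n\<^sup>2"
    using prods(2) by (intro divide_right_mono sum_mono) auto
  also have "\<dots> = V / n"
    using I n by (simp add: n_def power2_eq_square)
  finally have le: "expectation (\<lambda>\<omega>. (norm (A \<omega> - \<mu>))\<^sup>2) \<le> V / n" .
  have [measurable]: "random_variable borel (\<lambda>\<omega>. norm (A \<omega> - \<mu>))"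
    unfolding A_def using int by (auto intro!: measurable_compose[OF _ borel_measurable_norm] borel_measurable_diff borel_measurable_scaleR borel_measurable_sum)
  show "integrable M (\<lambda>\<omega>. norm (A \<omega> - \<mu>))"
    by (rule expectation_le_sqrt_second_moment[OF _ A_sq]) simp
  have "expectation (\<lambda>\<omega>. norm (A \<omega> - \<mu>)) \<le> sqrt (expectation (\<lambda>\<omega>. (norm (A \<omega> - \<mu>))\<^sup>2))"
    by (rule expectation_le_sqrt_second_moment[OF _ A_sq]) simp
  also have "\<dots> \<le> sqrt (V / real (card I))" using le by (simp add: n_def)
  finally show "expectation (\<lambda>\<omega>. norm (A \<omega> - \<mu>)) \<le> sqrt (V / real (card I))" .
qed

section \<open>Freezing one of two independent variables, and the random output index\<close>

text \<open>The joint law is a product, so Tonelli applies. Nonnegative integrals let it be used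
  before the gradient error is known to be integrable.\<close>

lemma nn_integral_indep_var:
  assumes ind: "indep_var S X N Y" and h [measurable]: "h \<in> borel_measurable (S \<Otimes>\<^sub>M N)"
  shows "(\<integral>\<^sup>+\<omega>. h (X \<omega>, Y \<omega>) \<partial>M) = (\<integral>\<^sup>+\<omega>. (\<integral>\<^sup>+\<omega>'. h (X \<omega>, Y \<omega>') \<partial>M) \<partial>M)"
proof -
  have [measurable]: "random_variable S X" "random_variable N Y"
    and eq: "distr M S X \<Otimes>\<^sub>M distr M N Y = distr M (S \<Otimes>\<^sub>M N) (\<lambda>\<omega>. (X \<omega>, Y \<omega>))"
    using ind by (auto simp: indep_var_distribution_eq)
  interpret Y: prob_space "distr M N Y" by (rule prob_space_distr) simp
  have sets [measurable_cong]: "sets (S \<Otimes>\<^sub>M distr M N Y) = sets (S \<Otimes>\<^sub>M N)" by simp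
  have inner [measurable]: "(\<lambda>x. \<integral>\<^sup>+y. h (x, y) \<partial>distr M N Y) \<in> borel_measurable S"
    by measurable
  have "(\<integral>\<^sup>+\<omega>. h (X \<omega>, Y \<omega>) \<partial>M) = (\<integral>\<^sup>+z. h z \<partial>(distr M S X \<Otimes>\<^sub>M distr M N Y))"
    unfolding eq by (subst nn_integral_distr) auto
  also have "\<dots> = (\<integral>\<^sup>+x. \<integral>\<^sup>+y. h (x, y) \<partial>distr M N Y \<partial>distr M S X)"
    by (intro Y.nn_integral_fst[symmetric]) simp
  also have "\<dots> = (\<integral>\<^sup>+\<omega>. \<integral>\<^sup>+y. h (X \<omega>, y) \<partial>distr M N Y \<partial>M)"
    by (subst nn_integral_distr) auto
  also have "\<dots> = (\<integral>\<^sup>+\<omega>. \<integral>\<^sup>+\<omega>'. h (X \<omega>, Y \<omega>') \<partial>M \<partial>M)"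
    by (intro nn_integral_cong nn_integral_distr) (auto dest: measurable_space)
  finally show ?thesis .
qed

text \<open>\<open>Y (\<tau> \<omega>) \<omega>\<close> is the sum over \<open>t\<close> of the
  indicator of \<open>\<tau> = t\<close> times \<open>Y t\<close>. As \<open>Y t\<close> is a
  function of the samples, each product factors, with the indicator contributing
  \<open>1 / T\<close>.\<close>

lemma uniform_index_expectation:
  assumes unif: "uniform_index M D T b \<xi> \<tau>" and T: "T > 0"
    and samples: "(\<lambda>\<omega>. \<lambda>p\<in>sample_indices T b. \<xi> p \<omega>) \<in> M \<rightarrow>\<^sub>M (\<Pi>\<^sub>M p\<in>sample_indices T b. D)"
      (is "?\<Xi> \<in> _")
    and h: "\<And>t. t < T \<Longrightarrow> h t \<in> borel_measurable (\<Pi>\<^sub>M p\<in>sample_indices T b. D)"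
    and Y: "\<And>t \<omega>. t < T \<Longrightarrow> \<omega> \<in> space M \<Longrightarrow> Y t \<omega> = h t (\<lambda>p\<in>sample_indices T b. \<xi> p \<omega>)"
    and int: "\<And>t. t < T \<Longrightarrow> integrable M (Y t)"
  shows "integrable M (\<lambda>\<omega>. Y (\<tau> \<omega>) \<omega> :: real)"
    "expectation (\<lambda>\<omega>. Y (\<tau> \<omega>) \<omega>) = (\<Sum>t<T. expectation (Y t)) / real T"
proof -
  have \<tau> [measurable]: "\<tau> \<in> M \<rightarrow>\<^sub>M count_space {..<T}"
    and distr: "distr M (count_space {..<T}) \<tau> = uniform_count_measure {..<T}"
    using unif by (auto simp: uniform_index_def)
  define U where "U t \<omega> = (indicator {t} (\<tau> \<omega>) :: real)" for t \<omega>
  have U_meas: "random_variable borel (U t)" for t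
    unfolding U_def by (rule measurable_compose[OF \<tau>]) simp
  \<comment> \<open>Intersection stability is what carries independence from preimage systems to the
    sigma-algebras they generate.\<close>
  have stable: "Int_stable {Z -` A \<inter> space M |A. A \<in> sets N}" for N :: "real measure" and Z
  proof (safe intro!: Int_stableI)
    fix A B assume "A \<in> sets N" "B \<in> sets N"
    then show "\<exists>C. Z -` A \<inter> space M \<inter> (Z -` B \<inter> space M) = Z -` C \<inter> space M \<and> C \<in> sets N"
      by (intro exI[of _ "A \<inter> B"]) auto
  qed
  have prod: "integrable M (\<lambda>\<omega>. U t \<omega> * Y t \<omega>)"
    "expectation (\<lambda>\<omega>. U t \<omega> * Y t \<omega>) = expectation (Y t) / real T" if t: "t < T" for t
  proof -
    have Y_meas: "random_variable borel (Y t)" using int[OF t] by simp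
    have "indep_set {U t -` A \<inter> space M |A. A \<in> sets borel} {Y t -` A \<inter> space M |A. A \<in> sets borel}"
    proof (rule indep_setI)
      fix a c assume "a \<in> {U t -` A \<inter> space M |A. A \<in> sets borel}" "c \<in> {Y t -` A \<inter> space M |A. A \<in> sets borel}"
      then obtain A C where a: "a = U t -` A \<inter> space M" and c: "c = Y t -` C \<inter> space M" and C: "C \<in> sets borel"
        by auto
      have "a = \<tau> -` {k \<in> {..<T}. indicator {t} k \<in> A} \<inter> space M"
        using measurable_space[OF \<tau>] by (auto simp: a U_def)
      then have a': "a \<in> {\<tau> -` A \<inter> space M |A. A \<in> sets (count_space {..<T})}"
        by (intro CollectI exI[of _ "{k \<in> {..<T}. indicator {t} k \<in> A}"]) auto
      have "c = ?\<Xi> -` (h t -` C \<inter> space (\<Pi>\<^sub>M p\<in>sample_indices T b. D)) \<inter> space M"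
        using Y[OF t] measurable_space[OF samples] by (auto simp: c)
      then have c': "c \<in> {?\<Xi> -` A \<inter> space M |A. A \<in> sets (\<Pi>\<^sub>M p\<in>sample_indices T b. D)}"
        using measurable_sets[OF h[OF t] C] by blast
      show "prob (a \<inter> c) = prob a * prob c"
        by (rule indep_setD[OF _ a' c']) (use unif in \<open>simp add: uniform_index_def\<close>)
    qed (use U_meas Y_meas in \<open>auto intro: measurable_sets\<close>)
    then have iv: "indep_var borel (U t) borel (Y t)"
      unfolding indep_var_eq using U_meas Y_meas by (intro conjI indep_set_sigma_sets stable) auto
    have U_int: "integrable M (U t)"
      by (rule integrable_const_bound[of _ 1]) (auto simp: U_meas, auto simp: U_def indicator_def)
    have "expectation (U t) = (\<integral>k. indicator {t} k \<partial>distr M (count_space {..<T}) \<tau>)"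
      unfolding U_def by (rule integral_distr[symmetric]) auto
    also have "\<dots> = 1 / real T"
      unfolding distr using t by (simp add: measure_uniform_count_measure)
    finally have "expectation (U t) = 1 / real T" .
    then show "integrable M (\<lambda>\<omega>. U t \<omega> * Y t \<omega>)"
      "expectation (\<lambda>\<omega>. U t \<omega> * Y t \<omega>) = expectation (Y t) / real T"
      using indep_var_integrable[OF iv U_int int[OF t]] indep_var_lebesgue_integral[OF iv U_int int[OF t]]
      by auto
  qed
  have eq: "Y (\<tau> \<omega>) \<omega> = (\<Sum>t<T. U t \<omega> * Y t \<omega>)" if "\<omega> \<in> space M" for \<omega>
  proof -
    have "(\<Sum>t<T. U t \<omega> * Y t \<omega>) = (\<Sum>t<T. if t = \<tau> \<omega> then Y t \<omega> else 0)"
      by (intro sum.cong) (auto simp: U_def)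
    then show ?thesis using measurable_space[OF \<tau> that] by simp
  qed
  have "integrable M (\<lambda>\<omega>. \<Sum>t<T. U t \<omega> * Y t \<omega>)"
    using prod(1) by (intro Bochner_Integration.integrable_sum) auto
  then show "integrable M (\<lambda>\<omega>. Y (\<tau> \<omega>) \<omega>)"
    by (subst Bochner_Integration.integrable_cong[OF refl eq])
  have "expectation (\<lambda>\<omega>. Y (\<tau> \<omega>) \<omega>) = expectation (\<lambda>\<omega>. \<Sum>t<T. U t \<omega> * Y t \<omega>)"
    by (intro Bochner_Integration.integral_cong refl eq)
  also have "\<dots> = (\<Sum>t<T. expectation (Y t)) / real T"
    using prod by (simp add: Bochner_Integration.integral_sum sum_divide_distrib)
  finally show "expectation (\<lambda>\<omega>. Y (\<tau> \<omega>) \<omega>) = (\<Sum>t<T. expectation (Y t)) / real T" .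
qed

end

lemma batch_gradient_measurable:
  fixes f :: "real ^ 'n \<Rightarrow> 's \<Rightarrow> real"
  assumes obj: "stochastic_objective D f F"
    and u: "u \<in> borel_measurable N" and s: "\<And>i. i < b \<Longrightarrow> s i \<in> N \<rightarrow>\<^sub>M D"
  shows "(\<lambda>z. batch_gradient f b (\<lambda>i. s i z) (u z)) \<in> borel_measurable N"
proof -
  have "(\<lambda>z. gradient (\<lambda>y. f y (s i z)) (u z)) \<in> borel_measurable N" if "i < b" for i
    using measurable_compose[OF measurable_Pair[OF u s[OF that]] gradient_joint_measurable[OF obj]]
    by simp
  then show ?thesis unfolding batch_gradient_def
    by (intro borel_measurable_scaleR borel_measurable_sum borel_measurable_const) auto
qed

subsection \<open>Runs with constant radius\<close>

text \<open>The subproblem is already solved here: the explicit step replaces \<open>d\<close> and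
  \<open>B\<close>. The assumption \<open>radius\<close> places every step within the range where
  smoothness applies.\<close>

locale constant_radius_run = prob_space M
  for f :: "real ^ 'n \<Rightarrow> 's \<Rightarrow> real" and F :: "real ^ 'n \<Rightarrow> real"
    and D :: "'s measure" and M :: "'w measure"
    and L0 L1 G0 G1 \<rho> \<Delta> :: real and x0 :: "real ^ 'n"
    and T b :: nat and \<xi> :: "nat \<times> nat \<Rightarrow> 'w \<Rightarrow> 's"
    and x g :: "nat \<Rightarrow> 'w \<Rightarrow> real ^ 'n" +
  assumes objective: "stochastic_objective D f F"
    and bounded_below: "bdd_below (range F)"
    and smooth: "L0L1_smooth F L0 L1"
    and unbiased: "unbiased_gradients D f F"
    and variance: "variance_bounded_gradients D f F G0 G1"
    and pos: "\<Delta> > 0" "\<rho> > 0" "b > 0"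
    and radius: "ereal \<Delta> \<le> 1 / ereal L1"
    and iid: "iid_samples M D (sample_indices T b) \<xi>"
    and start: "\<And>\<omega>. \<omega> \<in> space M \<Longrightarrow> x 0 \<omega> = x0"
    and g_eq: "\<And>t \<omega>. t < T \<Longrightarrow> \<omega> \<in> space M \<Longrightarrow> g t \<omega> = batch_gradient f b (\<lambda>i. \<xi> (t, i) \<omega>) (x t \<omega>)"
    and step: "\<And>t \<omega>. t < T \<Longrightarrow> \<omega> \<in> space M \<Longrightarrow> x (Suc t) \<omega> = x t \<omega> + tr_step \<Delta> \<rho> (g t \<omega>)"
begin

section \<open>Iterates as bounded functions of the earlier samples\<close>

abbreviation past :: "nat \<Rightarrow> 'w \<Rightarrow> nat \<times> nat \<Rightarrow> 's" where
  "past t \<omega> \<equiv> (\<lambda>p\<in>sample_indices t b. \<xi> p \<omega>)"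

lemma indep_samples: "indep_vars (\<lambda>_. D) \<xi> (sample_indices T b)"
  using iid by (simp add: iid_samples_def)

lemma sample_measurable: "p \<in> sample_indices T b \<Longrightarrow> \<xi> p \<in> M \<rightarrow>\<^sub>M D"
  using indep_samples by (auto simp: indep_vars_def)

lemma sample_distr: "p \<in> sample_indices T b \<Longrightarrow> distr M D (\<xi> p) = D"
  using iid by (simp add: iid_samples_def)

lemma sample_indices_mono: "s \<le> t \<Longrightarrow> sample_indices s b \<subseteq> sample_indices t b"
  by (auto simp: sample_indices_def)

lemma past_measurable:
  assumes "t \<le> T"
  shows "past t \<in> M \<rightarrow>\<^sub>M (\<Pi>\<^sub>M p\<in>sample_indices t b. D)"
  using sample_indices_mono[OF assms] by (intro measurable_restrict sample_measurable) auto

text \<open>An explicit factorization in place of adaptedness to a filtration. It gives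
  measurability of the iterate and its independence from the next batch and from the output
  index.\<close>

lemma iterate_function_of_past:
  assumes "t \<le> T"
  shows "\<exists>\<Phi>\<in>borel_measurable (\<Pi>\<^sub>M p\<in>sample_indices t b. D). \<forall>\<omega>\<in>space M. x t \<omega> = \<Phi> (past t \<omega>)"
  using assms
proof (induction t)
  case 0
  then show ?case using start by (intro bexI[of _ "\<lambda>_. x0"]) auto
next
  case (Suc t)
  obtain \<Phi> where \<Phi>: "\<Phi> \<in> borel_measurable (\<Pi>\<^sub>M p\<in>sample_indices t b. D)"
    and x: "\<And>\<omega>. \<omega> \<in> space M \<Longrightarrow> x t \<omega> = \<Phi> (past t \<omega>)"
    using Suc.IH[OF Suc_leD[OF Suc.prems]] by blast
  let ?P = "\<Pi>\<^sub>M p\<in>sample_indices (Suc t) b. D"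
  \<comment> \<open>The previous representation, lifted to the longer tuple by forgetting the newest
    batch.\<close>
  define u where "u s = \<Phi> (restrict s (sample_indices t b))" for s
  have mono: "sample_indices t b \<subseteq> sample_indices (Suc t) b" by (rule sample_indices_mono) simp
  have u [measurable]: "u \<in> borel_measurable ?P"
    unfolding u_def by (rule measurable_compose[OF measurable_restrict_subset[OF mono] \<Phi>])
  have [measurable]: "(\<lambda>s. batch_gradient f b (\<lambda>i. s (t, i)) (u s)) \<in> borel_measurable ?P"
    by (rule batch_gradient_measurable[OF objective u])
       (auto simp: sample_indices_def intro!: measurable_component_singleton)
  define \<Psi> where "\<Psi> s = u s + tr_step \<Delta> \<rho> (batch_gradient f b (\<lambda>i. s (t, i)) (u s))" for s
  have "\<Psi> \<in> borel_measurable ?P"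
    unfolding \<Psi>_def by measurable
  moreover have "x (Suc t) \<omega> = \<Psi> (past (Suc t) \<omega>)"
    if \<omega>: "\<omega> \<in> space M" for \<omega>
  proof -
    have "restrict (past (Suc t) \<omega>) (sample_indices t b) = past t \<omega>"
      using mono by (simp add: restrict_restrict Int_absorb1)
    then have "u (past (Suc t) \<omega>) = x t \<omega>" by (simp add: u_def x[OF \<omega>])
    moreover have "batch_gradient f b (\<lambda>i. past (Suc t) \<omega> (t, i)) (x t \<omega>) = g t \<omega>"
      using Suc.prems \<omega> by (auto simp: g_eq batch_gradient_def sample_indices_def)
    ultimately show ?thesis using step[of t \<omega>] Suc.prems \<omega> by (simp add: \<Psi>_def)
  qed
  ultimately show ?case by (intro bexI[of _ \<Psi>] ballI)
qed

lemma iterate_measurable: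
  assumes t: "t \<le> T"
  shows "x t \<in> borel_measurable M"
proof -
  obtain \<Phi> where \<Phi>: "\<Phi> \<in> borel_measurable (\<Pi>\<^sub>M p\<in>sample_indices t b. D)"
    and eq: "\<forall>\<omega>\<in>space M. x t \<omega> = \<Phi> (past t \<omega>)"
    using iterate_function_of_past[OF t] by (rule bexE)
  have x: "x t \<omega> = \<Phi> (past t \<omega>)" if "\<omega> \<in> space M" for \<omega> using eq that by (rule bspec)
  have "x t \<in> borel_measurable M \<longleftrightarrow> (\<lambda>\<omega>. \<Phi> (past t \<omega>)) \<in> borel_measurable M"
    by (rule measurable_cong) (rule x)
  also have "\<dots>"
    by (rule measurable_compose[OF past_measurable[OF t] \<Phi>])
  finally show ?thesis .
qed

text \<open>The ball does not depend on the outcome, so every continuous function of an iterate is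
  bounded and hence integrable.\<close>

lemma iterate_in_cball:
  assumes "t \<le> T" "\<omega> \<in> space M"
  shows "x t \<omega> \<in> cball x0 (real t * \<Delta>)"
  using assms
proof (induction t)
  case (Suc t)
  then have "norm (x0 - x t \<omega>) \<le> real t * \<Delta>" by (simp add: dist_norm)
  moreover have "norm (x t \<omega> - x (Suc t) \<omega>) \<le> \<Delta>"
    using Suc.prems step[of t \<omega>] norm_tr_step_le[OF pos(1,2)] by simp
  ultimately show ?case
    using norm_triangle_ineq[of "x0 - x t \<omega>" "x t \<omega> - x (Suc t) \<omega>"]
    by (simp add: dist_norm algebra_simps)
qed (simp add: start)

lemma integrable_continuous_iterate:
  fixes h :: "real ^ 'n \<Rightarrow> real"
  assumes t: "t \<le> T" and h: "continuous_on UNIV h"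
  shows "integrable M (\<lambda>\<omega>. h (x t \<omega>))"
proof -
  have "compact (h ` cball x0 (real t * \<Delta>))"
    by (intro compact_continuous_image continuous_on_subset[OF h] compact_cball) simp
  then obtain C where C: "\<And>y. y \<in> cball x0 (real t * \<Delta>) \<Longrightarrow> norm (h y) \<le> C"
    by (meson bounded_iff compact_imp_bounded imageI)
  show ?thesis
  proof (rule integrable_const_bound)
    show "AE \<omega> in M. norm (h (x t \<omega>)) \<le> C"
      using C iterate_in_cball[OF t] by (auto intro!: AE_I2)
    show "(\<lambda>\<omega>. h (x t \<omega>)) \<in> borel_measurable M"
      by (rule measurable_compose[OF iterate_measurable[OF t] borel_measurable_continuous_onI[OF h]])
  qed
qed

lemma F_continuous: "continuous_on UNIV F"
  using smooth unfolding L0L1_smooth_def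
  by (auto simp: continuous_on_eq_continuous_at intro: differentiable_imp_continuous_within)

lemma norm_gradient_continuous: "continuous_on UNIV (\<lambda>y. norm (gradient F y))"
  by (intro continuous_intros L0L1_gradient_continuous[OF smooth])

lemma gradient_measurable: "gradient F \<in> borel_measurable borel"
  by (rule borel_measurable_continuous_onI[OF L0L1_gradient_continuous[OF smooth]])

section \<open>Gradient error and telescoped expected decrease\<close>

text \<open>Here \<open>y\<close> is deterministic. Bounding the root of a sum of squares by the sum
  makes the estimate affine in the gradient norm, so it can later be averaged over a random
  point.\<close>

lemma batch_deviation:
  assumes t: "t < T"
  shows "integrable M (\<lambda>\<omega>. norm (batch_gradient f b (\<lambda>i. \<xi> (t, i) \<omega>) y - gradient F y))"
    "expectation (\<lambda>\<omega>. norm (batch_gradient f b (\<lambda>i. \<xi> (t, i) \<omega>) y - gradient F y))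
       \<le> (G0 + G1 * norm (gradient F y)) / sqrt (real b)"
proof -
  define J where "J = {t} \<times> {..<b}"
  define V where "V = G0\<^sup>2 + G1\<^sup>2 * (norm (gradient F y))\<^sup>2"
  define \<eta> where "\<eta> z = gradient (\<lambda>y. f y z) y" for z
  have J_eq: "J = Pair t ` {..<b}" by (auto simp: J_def)
  have J: "finite J" "J \<noteq> {}" "J \<subseteq> sample_indices T b" and card_J: "card J = b"
    using t pos by (auto simp: J_def sample_indices_def)
  have \<eta>: "has_bochner_integral D \<eta> (gradient F y)"
    using unbiased by (simp add: unbiased_gradients_def \<eta>_def[abs_def])
  have \<eta>_sq: "integrable D (\<lambda>z. (norm (\<eta> z - gradient F y))\<^sup>2)"
    "(\<integral>z. (norm (\<eta> z - gradient F y))\<^sup>2 \<partial>D) \<le> V"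
    using variance by (auto simp: variance_bounded_gradients_def V_def \<eta>_def)
  have \<eta>_meas [measurable]: "\<eta> \<in> borel_measurable D" using \<eta> by (auto simp: has_bochner_integral_iff)
  have ind: "indep_vars (\<lambda>_. borel) (\<lambda>p \<omega>. \<eta> (\<xi> p \<omega>)) J"
    by (rule indep_vars_compose2[OF indep_vars_subset[OF indep_samples J(3)]]) simp
  have \<xi>: "\<xi> p \<in> M \<rightarrow>\<^sub>M D" "distr M D (\<xi> p) = D" if "p \<in> J" for p
    using subsetD[OF J(3) that] sample_measurable sample_distr by blast+
  have transfer_int: "integrable M (\<lambda>\<omega>. k (\<xi> p \<omega>))"
    and transfer: "expectation (\<lambda>\<omega>. k (\<xi> p \<omega>)) = (\<integral>z. k z \<partial>D)"
    if "p \<in> J" "integrable D k" for p and k :: "'s \<Rightarrow> 'c :: {banach, second_countable_topology}"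
    using that \<xi>[OF that(1)] integrable_distr[OF \<xi>(1)[OF that(1)], of k]
      integral_distr[OF \<xi>(1)[OF that(1)], of k]
    by auto
  note dev = sample_mean_deviation[OF J(1,2) ind, of "gradient F y" V]
  have avg: "(1 / real b) *\<^sub>R (\<Sum>p\<in>J. \<eta> (\<xi> p \<omega>)) = batch_gradient f b (\<lambda>i. \<xi> (t, i) \<omega>) y" for \<omega>
    unfolding J_eq by (simp add: batch_gradient_def \<eta>_def sum.reindex inj_on_def)
  have prem: "p \<in> J \<Longrightarrow> integrable M (\<lambda>\<omega>. \<eta> (\<xi> p \<omega>))"
    "p \<in> J \<Longrightarrow> expectation (\<lambda>\<omega>. \<eta> (\<xi> p \<omega>)) = gradient F y"
    "p \<in> J \<Longrightarrow> integrable M (\<lambda>\<omega>. (norm (\<eta> (\<xi> p \<omega>) - gradient F y))\<^sup>2)"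
    "p \<in> J \<Longrightarrow> expectation (\<lambda>\<omega>. (norm (\<eta> (\<xi> p \<omega>) - gradient F y))\<^sup>2) \<le> V" for p
    using \<eta> \<eta>_sq transfer_int[of p \<eta>] transfer[of p \<eta>]
      transfer_int[of p "\<lambda>z. (norm (\<eta> z - gradient F y))\<^sup>2"]
      transfer[of p "\<lambda>z. (norm (\<eta> z - gradient F y))\<^sup>2"]
    by (auto simp: has_bochner_integral_iff)
  show "integrable M (\<lambda>\<omega>. norm (batch_gradient f b (\<lambda>i. \<xi> (t, i) \<omega>) y - gradient F y))"
    using dev(1)[OF prem] by (simp only: card_J avg)
  have "expectation (\<lambda>\<omega>. norm (batch_gradient f b (\<lambda>i. \<xi> (t, i) \<omega>) y - gradient F y)) \<le> sqrt (V / real b)"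
    using dev(2)[OF prem] by (simp only: card_J avg)
  also have "sqrt V \<le> G0 + G1 * norm (gradient F y)"
    using variance unfolding V_def power_mult_distrib[symmetric]
    by (intro sqrt_sum_squares_le_sum) (auto simp: variance_bounded_gradients_def)
  then have "sqrt (V / real b) \<le> (G0 + G1 * norm (gradient F y)) / sqrt (real b)"
    by (simp add: real_sqrt_divide divide_right_mono)
  finally show "expectation (\<lambda>\<omega>. norm (batch_gradient f b (\<lambda>i. \<xi> (t, i) \<omega>) y - gradient F y))
       \<le> (G0 + G1 * norm (gradient F y)) / sqrt (real b)" .
qed

text \<open>The iterate depends on earlier batches only, so conditioning on it reduces to a fixed point.\<close>

lemma gradient_error:
  assumes t: "t < T"
  shows "integrable M (\<lambda>\<omega>. norm (g t \<omega> - gradient F (x t \<omega>)))"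
    "expectation (\<lambda>\<omega>. norm (g t \<omega> - gradient F (x t \<omega>)))
       \<le> (G0 + G1 * expectation (\<lambda>\<omega>. norm (gradient F (x t \<omega>)))) / sqrt (real b)"
proof -
  define J where "J = {t} \<times> {..<b}"
  define E where "E \<omega> = (G0 + G1 * norm (gradient F (x t \<omega>))) / sqrt (real b)" for \<omega>
  let ?P = "\<Pi>\<^sub>M p\<in>sample_indices t b. D" and ?Q = "\<Pi>\<^sub>M p\<in>J. D"
  let ?Y = "\<lambda>\<omega>. \<lambda>p\<in>J. \<xi> p \<omega>"
  obtain \<Phi> where \<Phi>: "\<Phi> \<in> borel_measurable ?P"
    and eq: "\<forall>\<omega>\<in>space M. x t \<omega> = \<Phi> (past t \<omega>)"
    using iterate_function_of_past[OF less_imp_le[OF t]] by (rule bexE)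
  have x: "x t \<omega> = \<Phi> (past t \<omega>)" if "\<omega> \<in> space M" for \<omega> using eq that by (rule bspec)
  \<comment> \<open>The first component carries the past samples, the second the current batch;
    under the inner integral of Tonelli the iterate is therefore fixed.\<close>
  define h where "h z = ennreal (norm (batch_gradient f b (\<lambda>i. snd z (t, i)) (\<Phi> (fst z)) - gradient F (\<Phi> (fst z))))"
    for z :: "(nat \<times> nat \<Rightarrow> 's) \<times> (nat \<times> nat \<Rightarrow> 's)"
  have u: "(\<lambda>z. \<Phi> (fst z)) \<in> borel_measurable (?P \<Otimes>\<^sub>M ?Q)"
    by (rule measurable_compose[OF measurable_fst \<Phi>])
  have [measurable]: "(\<lambda>z. batch_gradient f b (\<lambda>i. snd z (t, i)) (\<Phi> (fst z))) \<in> borel_measurable (?P \<Otimes>\<^sub>M ?Q)"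
    by (rule batch_gradient_measurable[OF objective u])
       (auto simp: J_def intro!: measurable_compose[OF measurable_snd measurable_component_singleton])
  have [measurable]: "(\<lambda>z. gradient F (\<Phi> (fst z))) \<in> borel_measurable (?P \<Otimes>\<^sub>M ?Q)"
    by (rule measurable_compose[OF u gradient_measurable])
  have h: "h \<in> borel_measurable (?P \<Otimes>\<^sub>M ?Q)"
    unfolding h_def by measurable
  have iv: "indep_var ?P (past t) ?Q ?Y"
    using t by (intro indep_var_restrict[OF indep_samples]) (auto simp: J_def sample_indices_def)
  have h_eq: "h (past t \<omega>, ?Y \<omega>')
      = ennreal (norm (batch_gradient f b (\<lambda>i. \<xi> (t, i) \<omega>') (x t \<omega>) - gradient F (x t \<omega>)))"
    if "\<omega> \<in> space M" for \<omega> \<omega>'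
    using that by (simp add: h_def x batch_gradient_def J_def)
  have E_int: "integrable M E"
    unfolding E_def using t pos
    by (intro integrable_continuous_iterate continuous_intros L0L1_gradient_continuous[OF smooth]) auto
  have E_nonneg: "E \<omega> \<ge> 0" for \<omega>
    using variance by (simp add: E_def variance_bounded_gradients_def)
  have "(\<integral>\<^sup>+\<omega>. norm (g t \<omega> - gradient F (x t \<omega>)) \<partial>M) = (\<integral>\<^sup>+\<omega>. h (past t \<omega>, ?Y \<omega>) \<partial>M)"
    by (intro nn_integral_cong) (simp add: h_eq g_eq[OF t])
  also have "\<dots> = (\<integral>\<^sup>+\<omega>. (\<integral>\<^sup>+\<omega>'. h (past t \<omega>, ?Y \<omega>') \<partial>M) \<partial>M)"
    by (rule nn_integral_indep_var[OF iv h])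
  also have "\<dots> \<le> (\<integral>\<^sup>+\<omega>. E \<omega> \<partial>M)"
  proof (rule nn_integral_mono)
    fix \<omega> assume \<omega>: "\<omega> \<in> space M"
    show "(\<integral>\<^sup>+\<omega>'. h (past t \<omega>, ?Y \<omega>') \<partial>M) \<le> ennreal (E \<omega>)"
      unfolding h_eq[OF \<omega>] E_def
      using batch_deviation[OF t, of "x t \<omega>"] by (subst nn_integral_eq_integral) (auto intro: ennreal_leI)
  qed
  also have "\<dots> = ennreal (expectation E)"
    using E_int E_nonneg by (intro nn_integral_eq_integral) auto
  finally have le: "(\<integral>\<^sup>+\<omega>. norm (g t \<omega> - gradient F (x t \<omega>)) \<partial>M) \<le> ennreal (expectation E)" .
  have x_meas: "x t \<in> borel_measurable M" using iterate_measurable t by simp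
  have "(\<lambda>\<omega>. batch_gradient f b (\<lambda>i. \<xi> (t, i) \<omega>) (x t \<omega>)) \<in> borel_measurable M"
    using t by (intro batch_gradient_measurable[OF objective x_meas] sample_measurable) (auto simp: sample_indices_def)
  moreover have "g t \<in> borel_measurable M \<longleftrightarrow>
      (\<lambda>\<omega>. batch_gradient f b (\<lambda>i. \<xi> (t, i) \<omega>) (x t \<omega>)) \<in> borel_measurable M"
    by (rule measurable_cong) (rule g_eq[OF t])
  ultimately have "g t \<in> borel_measurable M" by (simp only:)
  then have meas [measurable]: "(\<lambda>\<omega>. norm (g t \<omega> - gradient F (x t \<omega>))) \<in> borel_measurable M"
    using measurable_compose[OF x_meas gradient_measurable] by measurable
  \<comment> \<open>The bound just obtained is finite, and this is what proves
    integrability.\<close>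
  show int: "integrable M (\<lambda>\<omega>. norm (g t \<omega> - gradient F (x t \<omega>)))"
    using le by (intro integrableI_bounded meas) (auto simp: le_less_trans[OF _ ennreal_less_top])
  have "expectation (\<lambda>\<omega>. norm (g t \<omega> - gradient F (x t \<omega>))) \<le> expectation E"
    using le E_nonneg unfolding nn_integral_eq_integral[OF int AE_I2, simplified]
    by (simp add: ennreal_le_iff integral_nonneg)
  also have "\<dots> = (G0 + G1 * expectation (\<lambda>\<omega>. norm (gradient F (x t \<omega>)))) / sqrt (real b)"
    using integrable_continuous_iterate[OF _ norm_gradient_continuous, of t] t
    by (simp add: E_def[abs_def] prob_space)
  finally show "expectation (\<lambda>\<omega>. norm (g t \<omega> - gradient F (x t \<omega>)))
       \<le> (G0 + G1 * expectation (\<lambda>\<omega>. norm (gradient F (x t \<omega>)))) / sqrt (real b)" .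
qed

lemma expected_decrease:
  assumes t: "t < T"
  defines "N \<equiv> expectation (\<lambda>\<omega>. norm (gradient F (x t \<omega>)))"
  shows "\<Delta> * N - 2 * \<Delta> * ((G0 + G1 * N) / sqrt (real b)) - (L0 + \<rho> + L1 * N) / 2 * \<Delta>\<^sup>2
    \<le> expectation (\<lambda>\<omega>. F (x t \<omega>)) - expectation (\<lambda>\<omega>. F (x (Suc t) \<omega>))"
proof -
  let ?n = "\<lambda>\<omega>. norm (gradient F (x t \<omega>))" and ?e = "\<lambda>\<omega>. norm (g t \<omega> - gradient F (x t \<omega>))"
  have int [simp]: "integrable M ?n" "integrable M (\<lambda>\<omega>. F (x t \<omega>))" "integrable M (\<lambda>\<omega>. F (x (Suc t) \<omega>))" "integrable M ?e"
    using t gradient_error(1)[OF t] by (auto intro!: integrable_continuous_iterate F_continuous norm_gradient_continuous)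
  have "expectation (\<lambda>\<omega>. F (x (Suc t) \<omega>))
      \<le> expectation (\<lambda>\<omega>. F (x t \<omega>) - \<Delta> * ?n \<omega> + 2 * \<Delta> * ?e \<omega> + (L0 + \<rho> + L1 * ?n \<omega>) / 2 * \<Delta>\<^sup>2)"
  proof (rule integral_mono)
    fix \<omega> assume \<omega>: "\<omega> \<in> space M"
    show "F (x (Suc t) \<omega>) \<le> F (x t \<omega>) - \<Delta> * ?n \<omega> + 2 * \<Delta> * ?e \<omega> + (L0 + \<rho> + L1 * ?n \<omega>) / 2 * \<Delta>\<^sup>2"
      unfolding step[OF t \<omega>] by (intro tr_step_decrease[OF smooth pos(1,2) radius])
  qed simp_all
  also have "\<dots> = expectation (\<lambda>\<omega>. F (x t \<omega>)) - \<Delta> * N + 2 * \<Delta> * expectation ?e + (L0 + \<rho> + L1 * N) / 2 * \<Delta>\<^sup>2"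
  proof -
    have "expectation (\<lambda>\<omega>. (L0 + \<rho> + L1 * ?n \<omega>) / 2 * \<Delta>\<^sup>2) = (L0 + \<rho> + L1 * N) / 2 * \<Delta>\<^sup>2"
      by (simp add: N_def prob_space)
    moreover have "integrable M (\<lambda>\<omega>. (L0 + \<rho> + L1 * ?n \<omega>) / 2 * \<Delta>\<^sup>2)"
      by (intro integrable_mult_left integrable_divide integrable_add integrable_const integrable_mult_right int) auto
    ultimately show ?thesis by (simp add: N_def del: integral_mult_left_zero integral_divide_zero)
  qed
  also have "2 * \<Delta> * expectation ?e \<le> 2 * \<Delta> * ((G0 + G1 * N) / sqrt (real b))"
    using gradient_error(2)[OF t] pos unfolding N_def by (intro mult_left_mono) auto
  finally show ?thesis by simp
qed

lemma sum_expected_gradient: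
  defines "S \<equiv> \<Sum>t<T. expectation (\<lambda>\<omega>. norm (gradient F (x t \<omega>)))"
  shows "\<Delta> * S - 2 * \<Delta> * ((G0 * T + G1 * S) / sqrt (real b)) - ((L0 + \<rho>) * T + L1 * S) / 2 * \<Delta>\<^sup>2
    \<le> F x0 - (INF y. F y)"
proof -
  define N where "N t = expectation (\<lambda>\<omega>. norm (gradient F (x t \<omega>)))" for t
  have "\<Delta> * S - 2 * \<Delta> * ((G0 * T + G1 * S) / sqrt (real b)) - ((L0 + \<rho>) * T + L1 * S) / 2 * \<Delta>\<^sup>2
      = (\<Sum>t<T. \<Delta> * N t - 2 * \<Delta> * ((G0 + G1 * N t) / sqrt (real b)) - (L0 + \<rho> + L1 * N t) / 2 * \<Delta>\<^sup>2)"
  proof -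
    \<comment> \<open>Each summand is affine in \<open>N t\<close>, namely
      \<open>\<alpha> * N t - \<beta>\<close>, so the sum depends only on \<open>S\<close> and
      \<open>T\<close>.\<close>
    define \<alpha> where "\<alpha> = \<Delta> - 2 * \<Delta> * (G1 / sqrt (real b)) - L1 / 2 * \<Delta>\<^sup>2"
    define \<beta> where "\<beta> = 2 * \<Delta> * (G0 / sqrt (real b)) + (L0 + \<rho>) / 2 * \<Delta>\<^sup>2"
    have "\<Delta> * N t - 2 * \<Delta> * ((G0 + G1 * N t) / sqrt (real b)) - (L0 + \<rho> + L1 * N t) / 2 * \<Delta>\<^sup>2
        = \<alpha> * N t - \<beta>" for t
      by (simp add: \<alpha>_def \<beta>_def algebra_simps add_divide_distrib)
    then have "(\<Sum>t<T. \<Delta> * N t - 2 * \<Delta> * ((G0 + G1 * N t) / sqrt (real b)) - (L0 + \<rho> + L1 * N t) / 2 * \<Delta>\<^sup>2)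
        = \<alpha> * S - real T * \<beta>"
      by (simp add: sum_subtractf sum_distrib_left S_def N_def)
    then show ?thesis
      by (simp add: \<alpha>_def \<beta>_def algebra_simps add_divide_distrib)
  qed
  also have "\<dots> \<le> (\<Sum>t<T. expectation (\<lambda>\<omega>. F (x t \<omega>)) - expectation (\<lambda>\<omega>. F (x (Suc t) \<omega>)))"
    using expected_decrease by (intro sum_mono) (simp add: N_def)
  also have "\<dots> = expectation (\<lambda>\<omega>. F (x 0 \<omega>)) - expectation (\<lambda>\<omega>. F (x T \<omega>))"
    by (rule sum_lessThan_telescope')
  also have "expectation (\<lambda>\<omega>. F (x 0 \<omega>)) = F x0"
    using start by (simp add: prob_space cong: Bochner_Integration.integral_cong)
  also have "F x0 - expectation (\<lambda>\<omega>. F (x T \<omega>)) \<le> F x0 - (INF y. F y)"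
    using integral_mono[OF integrable_const[of "INF y. F y"] integrable_continuous_iterate[OF order_refl F_continuous]]
      bounded_below
    by (simp add: prob_space cINF_lower)
  finally show ?thesis .
qed

end

subsection \<open>Rate and complexity\<close>

text \<open>The bound on \<open>\<epsilon>\<close> makes the terms proportional to the gradient norm absorb at most half of the
  decrease \<open>\<Delta> S\<close>; the remaining error terms are \<open>\<Delta> \<epsilon> T / 4\<close> and at most \<open>\<Delta> \<epsilon> T / 8\<close>.\<close>

lemma mean_gradient_le:
  fixes S T b \<epsilon> L0 L1 G0 G1 \<rho> \<Delta>F :: real
  assumes pos: "\<epsilon> > 0" "L0 > 0" "\<rho> > 0" "G0 > 0" and nonneg: "G1 \<ge> 0" "S \<ge> 0" and T: "T > 0"
    and \<epsilon>: "\<epsilon> * (L1 * G0 + 2 * L0 * G1 + 8 * \<rho> * G1) \<le> 4 * L0 * G0 + 16 * \<rho> * G0"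
    and \<Delta>: "\<Delta> = \<epsilon> / (4 * L0 + 16 * \<rho>)"
    and b: "b \<ge> 64 * G0\<^sup>2 / \<epsilon>\<^sup>2" and T_ge: "T \<ge> 32 * \<Delta>F * (L0 + 4 * \<rho>) / \<epsilon>\<^sup>2"
    and decrease: "\<Delta> * S - 2 * \<Delta> * ((G0 * T + G1 * S) / sqrt b)
      - ((L0 + \<rho>) * T + L1 * S) / 2 * \<Delta>\<^sup>2 \<le> \<Delta>F"
  shows "S / T \<le> \<epsilon>"
proof -
  define K where "K = L0 + 4 * \<rho>"
  have K: "K > 0" and \<Delta>_K: "\<Delta> = \<epsilon> / (4 * K)" and \<Delta>_pos: "\<Delta> > 0"
    using pos by (auto simp: K_def \<Delta> algebra_simps)
  \<comment> \<open>The constant 64 is the square of 8: the noise factor \<open>1 / sqrt b\<close>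
    becomes at most \<open>\<epsilon> / (8 * G0)\<close>.\<close>
  have "8 * G0 / \<epsilon> = sqrt (64 * G0\<^sup>2 / \<epsilon>\<^sup>2)"
    using pos by (simp add: real_sqrt_divide real_sqrt_mult)
  also have "\<dots> \<le> sqrt b" using b by simp
  finally have sqrt_b: "8 * G0 / \<epsilon> \<le> sqrt b" .
  have "(G0 * T + G1 * S) / sqrt b \<le> (G0 * T + G1 * S) / (8 * G0 / \<epsilon>)"
    using pos nonneg T sqrt_b by (intro divide_left_mono mult_pos_pos less_le_trans[OF _ sqrt_b]) auto
  also have "\<dots> = \<epsilon> / 8 * T + \<epsilon> * G1 / (8 * G0) * S"
    using pos by (simp add: field_simps)
  finally have noise: "2 * \<Delta> * ((G0 * T + G1 * S) / sqrt b)
      \<le> 2 * \<Delta> * (\<epsilon> / 8 * T + \<epsilon> * G1 / (8 * G0) * S)"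
    using \<Delta>_pos by (intro mult_left_mono) auto
  \<comment> \<open>The total coefficient of \<open>\<Delta> * S\<close> from noise and curvature;
    the hypothesis on \<open>\<epsilon>\<close>, divided by \<open>8 * G0 * K\<close>, bounds it by
    one half.\<close>
  have "\<epsilon> * G1 / (4 * G0) + L1 * \<Delta> / 2 = \<epsilon> * (L1 * G0 + 2 * G1 * K) / (8 * G0 * K)"
    using pos K by (simp add: \<Delta>_K field_simps)
  also have "\<dots> \<le> (4 * K * G0) / (8 * G0 * K)"
    using \<epsilon> pos K by (intro divide_right_mono) (auto simp: K_def algebra_simps)
  also have "\<dots> = 1 / 2" using pos K by simp
  finally have "(\<epsilon> * G1 / (4 * G0) + L1 * \<Delta> / 2) * (\<Delta> * S) \<le> 1 / 2 * (\<Delta> * S)"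
    using \<Delta>_pos nonneg by (intro mult_right_mono) auto
  moreover have "(L0 + \<rho>) * T / 2 * \<Delta>\<^sup>2 \<le> \<Delta> * \<epsilon> * T / 8"
  proof -
    have "(L0 + \<rho>) * T / 2 * \<Delta>\<^sup>2 \<le> K * T / 2 * \<Delta>\<^sup>2"
      using pos T by (intro mult_right_mono divide_right_mono) (auto simp: K_def)
    also have "\<dots> = \<Delta> * \<epsilon> * T / 8" using K by (simp add: \<Delta>_K field_simps power2_eq_square)
    finally show ?thesis .
  qed
  \<comment> \<open>Since \<open>\<Delta> * \<epsilon> / 8\<close> equals
    \<open>\<epsilon>\<^sup>2 / (32 * K)\<close>, this is the lower bound on \<open>T\<close> and
    the origin of its constant 32.\<close>
  moreover have "\<Delta>F \<le> \<Delta> * \<epsilon> * T / 8"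
    using T_ge pos K unfolding K_def[symmetric] by (simp add: \<Delta>_K field_simps power2_eq_square)
  \<comment> \<open>In units of \<open>\<Delta> * \<epsilon> * T\<close>, noise, curvature and gap
    add up to 1/4 + 1/8 + 1/8 = 1/2.\<close>
  ultimately have "\<Delta> * S / 2 \<le> \<Delta> * \<epsilon> * T / 2"
    using decrease noise by (simp add: algebra_simps add_divide_distrib power2_eq_square)
  then have "\<Delta> * S \<le> \<Delta> * (\<epsilon> * T)" by simp
  then have "S \<le> \<epsilon> * T" using \<Delta>_pos by simp
  then show ?thesis using T by (simp add: field_simps)
qed

text \<open>For small \<open>\<epsilon>\<close> both unrounded counts are at least 1, so each
  ceiling costs at most a factor 2. With \<open>L0 + 4 * \<rho> \<le> 4 * (L0 + \<rho>)\<close> the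
  constant is 2 * 2 * 64 * 32 * 4 = 32768.\<close>

lemma sample_complexity:
  assumes pos: "\<Delta>F > 0" "L0 > 0" "\<rho> > 0" "G0 > 0"
  shows "\<forall>\<^sub>F \<epsilon> in at_right 0.
    real (card (sample_indices (num_iterations \<Delta>F L0 \<rho> \<epsilon>) (batch_size G0 \<epsilon>)))
      \<le> 32768 * (\<Delta>F * (L0 + \<rho>) * G0\<^sup>2 / \<epsilon> ^ 4)"
proof -
  define A where "A = 32 * \<Delta>F * (L0 + 4 * \<rho>)"
  have A: "A > 0" using pos by (simp add: A_def)
  define r where "r = min (sqrt A) (8 * G0)"
  have "r > 0" using A pos by (simp add: r_def)
  then have "\<forall>\<^sub>F \<epsilon> in at_right 0. \<epsilon> \<in> {0<..<r}"
    by (rule eventually_at_right_real)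
  then show ?thesis
  proof eventually_elim
    case (elim \<epsilon>)
    have ceil: "real (nat \<lceil>u\<rceil>) \<le> 2 * u" if "u \<ge> 1" for u :: real
      using that by linarith
    have "\<epsilon>\<^sup>2 \<le> (sqrt A)\<^sup>2" "\<epsilon>\<^sup>2 \<le> (8 * G0)\<^sup>2"
      using elim by (intro power_mono; simp add: r_def)+
    then have "A / \<epsilon>\<^sup>2 \<ge> 1" "64 * G0\<^sup>2 / \<epsilon>\<^sup>2 \<ge> 1"
      using A elim by (auto simp: power_mult_distrib)
    then have T: "real (num_iterations \<Delta>F L0 \<rho> \<epsilon>) \<le> 2 * (A / \<epsilon>\<^sup>2)"
      and b: "real (batch_size G0 \<epsilon>) \<le> 2 * (64 * G0\<^sup>2 / \<epsilon>\<^sup>2)"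
      unfolding num_iterations_def batch_size_def A_def[symmetric] by (simp_all only: ceil)
    have "real (card (sample_indices (num_iterations \<Delta>F L0 \<rho> \<epsilon>) (batch_size G0 \<epsilon>)))
        \<le> 2 * (A / \<epsilon>\<^sup>2) * (2 * (64 * G0\<^sup>2 / \<epsilon>\<^sup>2))"
      unfolding sample_indices_def card_cartesian_product card_lessThan of_nat_mult
      by (rule mult_mono[OF T b]) (use A in auto)
    also have "\<dots> = 256 * A * G0\<^sup>2 / \<epsilon> ^ 4"
      by (simp add: power2_eq_square power4_eq_xxxx)
    also have "\<dots> \<le> 256 * (128 * (\<Delta>F * (L0 + \<rho>))) * G0\<^sup>2 / \<epsilon> ^ 4"
      using pos by (intro divide_right_mono mult_right_mono mult_left_mono) (auto simp: A_def algebra_simps)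
    finally show ?case by (simp add: mult.assoc)
  qed
qed

theorem corollary2:
  fixes f :: "real ^ 'n \<Rightarrow> 's \<Rightarrow> real" and F :: "real ^ 'n \<Rightarrow> real"
    and D :: "'s measure" and M :: "'w measure"
    and L0 L1 G0 G1 \<rho> \<Delta>F :: real and x0 :: "real ^ 'n"
    and \<Delta> :: "nat \<Rightarrow> 'w \<Rightarrow> real" and B :: "nat \<Rightarrow> 'w \<Rightarrow> real ^ 'n ^ 'n"
    and T b :: nat and \<xi> :: "nat \<times> nat \<Rightarrow> 'w \<Rightarrow> 's"
    and x g d :: "nat \<Rightarrow> 'w \<Rightarrow> real ^ 'n"
  assumes objective: "stochastic_objective D f F"
    and bounded_below: "bdd_below (range F)"
    and smooth: "L0L1_smooth F L0 L1"
    and unbiased: "unbiased_gradients D f F"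
    and variance: "variance_bounded_gradients D f F G0 G1"
    and gap_def: "\<Delta>F = F x0 - (INF y. F y)"
    and gap_pos: "\<Delta>F > 0"
    and rho_pos: "\<rho> > 0"
    and run: "trust_region_run M D f F B \<Delta> x0 T b \<xi> x g d"
    and B_eq: "\<forall>t<T. \<forall>\<omega>\<in>space M. B t \<omega> = mat \<rho>"
  shows
    "(\<forall>t<T. \<forall>\<omega>\<in>space M.
        let s = real_of_ereal (min (ereal (\<Delta> t \<omega>) / ereal (norm (g t \<omega>))) (ereal (1 / \<rho>)))
                  *\<^sub>R (- g t \<omega>)
        in d (Suc t) \<omega> = s \<and>
           (\<forall>v. tr_solution (F (x t \<omega>)) (g t \<omega>) (B t \<omega>) (\<Delta> t \<omega>) v \<longleftrightarrow> v = s))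
   \<and> (\<forall>\<epsilon>>0.
        ereal \<epsilon> \<le> min (ereal (4 * L0 * G0 + 16 * \<rho> * G0)
                          / ereal (L1 * G0 + 2 * L0 * G1 + 8 * \<rho> * G1))
                       (ereal (4 * L0 + 16 * \<rho>) / ereal L1) \<longrightarrow>
        (\<forall>t<T. \<forall>\<omega>\<in>space M. \<Delta> t \<omega> = \<epsilon> / (4 * L0 + 16 * \<rho>)) \<longrightarrow>
        b = batch_size G0 \<epsilon> \<longrightarrow>
        T = num_iterations \<Delta>F L0 \<rho> \<epsilon> \<longrightarrow>
        (\<forall>\<tau>. uniform_index M D T b \<xi> \<tau> \<longrightarrow>
           integrable M (\<lambda>\<omega>. norm (gradient F (x (\<tau> \<omega>) \<omega>))) \<and>
           (\<integral>\<omega>. norm (gradient F (x (\<tau> \<omega>) \<omega>)) \<partial>M) \<le> \<epsilon>))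
   \<and> (\<exists>C>0. \<forall>\<Delta>F' L0' \<rho>' G0' :: real. \<Delta>F' > 0 \<and> L0' > 0 \<and> \<rho>' > 0 \<and> G0' > 0 \<longrightarrow>
        (\<forall>\<^sub>F \<epsilon> in at_right 0.
           real (card (sample_indices (num_iterations \<Delta>F' L0' \<rho>' \<epsilon>) (batch_size G0' \<epsilon>)))
             \<le> C * (\<Delta>F' * (L0' + \<rho>') * G0'\<^sup>2 / \<epsilon> ^ 4)))"
proof (intro conjI)
  have \<Delta>_pos: "\<Delta> t \<omega> > 0"
    and g_eq: "g t \<omega> = batch_gradient f b (\<lambda>i. \<xi> (t, i) \<omega>) (x t \<omega>)"
    and sol: "tr_solution (F (x t \<omega>)) (g t \<omega>) (B t \<omega>) (\<Delta> t \<omega>) (d (Suc t) \<omega>)"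
    and x_Suc: "x (Suc t) \<omega> = x t \<omega> + d (Suc t) \<omega>"
    if "t < T" "\<omega> \<in> space M" for t \<omega>
    using run that unfolding trust_region_run_def by blast+
  have d_eq: "d (Suc t) \<omega> = tr_step (\<Delta> t \<omega>) \<rho> (g t \<omega>)" if "t < T" "\<omega> \<in> space M" for t \<omega>
    using sol[OF that] B_eq that by (simp add: tr_solution_iff[OF \<Delta>_pos rho_pos])
  show "\<forall>t<T. \<forall>\<omega>\<in>space M.
        let s = real_of_ereal (min (ereal (\<Delta> t \<omega>) / ereal (norm (g t \<omega>))) (ereal (1 / \<rho>)))
                  *\<^sub>R (- g t \<omega>)
        in d (Suc t) \<omega> = s \<and>
           (\<forall>v. tr_solution (F (x t \<omega>)) (g t \<omega>) (B t \<omega>) (\<Delta> t \<omega>) v \<longleftrightarrow> v = s)"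
    unfolding tr_step_def[symmetric] Let_def
    using d_eq B_eq by (simp add: tr_solution_iff[OF \<Delta>_pos rho_pos])
  show "\<forall>\<epsilon>>0.
        ereal \<epsilon> \<le> min (ereal (4 * L0 * G0 + 16 * \<rho> * G0)
                          / ereal (L1 * G0 + 2 * L0 * G1 + 8 * \<rho> * G1))
                       (ereal (4 * L0 + 16 * \<rho>) / ereal L1) \<longrightarrow>
        (\<forall>t<T. \<forall>\<omega>\<in>space M. \<Delta> t \<omega> = \<epsilon> / (4 * L0 + 16 * \<rho>)) \<longrightarrow>
        b = batch_size G0 \<epsilon> \<longrightarrow>
        T = num_iterations \<Delta>F L0 \<rho> \<epsilon> \<longrightarrow>
        (\<forall>\<tau>. uniform_index M D T b \<xi> \<tau> \<longrightarrow>
           integrable M (\<lambda>\<omega>. norm (gradient F (x (\<tau> \<omega>) \<omega>))) \<and>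
           (\<integral>\<omega>. norm (gradient F (x (\<tau> \<omega>) \<omega>)) \<partial>M) \<le> \<epsilon>)"
  proof (intro allI impI)
    fix \<epsilon> :: real and \<tau>
    assume \<epsilon>: "\<epsilon> > 0"
      and \<epsilon>_le: "ereal \<epsilon> \<le> min (ereal (4 * L0 * G0 + 16 * \<rho> * G0)
                          / ereal (L1 * G0 + 2 * L0 * G1 + 8 * \<rho> * G1))
                       (ereal (4 * L0 + 16 * \<rho>) / ereal L1)"
      and \<Delta>_eq: "\<forall>t<T. \<forall>\<omega>\<in>space M. \<Delta> t \<omega> = \<epsilon> / (4 * L0 + 16 * \<rho>)"
      and b: "b = batch_size G0 \<epsilon>" and T: "T = num_iterations \<Delta>F L0 \<rho> \<epsilon>"
      and unif: "uniform_index M D T b \<xi> \<tau>"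
    define \<delta> where "\<delta> = \<epsilon> / (4 * L0 + 16 * \<rho>)"
    have L: "L0 > 0" "L1 \<ge> 0" using smooth by (auto simp: L0L1_smooth_def)
    have G: "G0 > 0" "G1 \<ge> 0" using variance by (auto simp: variance_bounded_gradients_def)
    \<comment> \<open>Clears the extended quotients: if \<open>c = 0\<close> the quotient is
      infinite and the product form holds because \<open>a\<close> is positive.\<close>
    have clear: "\<epsilon> * c \<le> a" if "ereal \<epsilon> \<le> ereal a / ereal c" "a > 0" "c \<ge> 0" for a c
      using that by (cases "c = 0") (auto simp: field_simps)
    have \<epsilon>1: "\<epsilon> * (L1 * G0 + 2 * L0 * G1 + 8 * \<rho> * G1) \<le> 4 * L0 * G0 + 16 * \<rho> * G0"
      using \<epsilon>_le L G rho_pos by (intro clear) (auto intro!: add_pos_pos add_nonneg_nonneg)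
    have \<epsilon>2: "\<epsilon> * L1 \<le> 4 * L0 + 16 * \<rho>"
      using \<epsilon>_le L rho_pos by (intro clear) auto
    have \<delta>: "\<delta> > 0" using \<epsilon> L rho_pos by (simp add: \<delta>_def add_pos_pos)
    have radius: "ereal \<delta> \<le> 1 / ereal L1"
    proof (cases "L1 = 0")
      case True
      then show ?thesis by (simp add: divide_ereal_def)
    next
      case False
      then have "\<delta> \<le> 1 / L1" using \<epsilon>2 L rho_pos by (simp add: \<delta>_def field_simps)
      then show ?thesis using False by (simp add: one_ereal_def)
    qed
    interpret constant_radius_run f F D M L0 L1 G0 G1 \<rho> \<delta> x0 T b \<xi> x g
    proof -
      interpret prob_space M using run by (simp add: trust_region_run_def)
      show "constant_radius_run f F D M L0 L1 G0 G1 \<rho> \<delta> x0 T b \<xi> x g"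
      proof
        show "x (Suc t) \<omega> = x t \<omega> + tr_step \<delta> \<rho> (g t \<omega>)" if "t < T" "\<omega> \<in> space M" for t \<omega>
          using d_eq[OF that] x_Suc[OF that] \<Delta>_eq that by (simp add: \<delta>_def)
      qed (use assms \<delta> radius g_eq in \<open>simp_all add: trust_region_run_def\<close>)
    qed
    define S where "S = (\<Sum>t<T. expectation (\<lambda>\<omega>. norm (gradient F (x t \<omega>))))"
    have T_ge: "real T \<ge> 32 * \<Delta>F * (L0 + 4 * \<rho>) / \<epsilon>\<^sup>2" and b_ge: "real b \<ge> 64 * G0\<^sup>2 / \<epsilon>\<^sup>2"
      by (auto simp: T b num_iterations_def batch_size_def intro: real_nat_ceiling_ge)
    moreover have "32 * \<Delta>F * (L0 + 4 * \<rho>) / \<epsilon>\<^sup>2 > 0" using gap_pos L rho_pos \<epsilon> by simp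
    \<comment> \<open>Positivity of the gap ensures at least one iteration, so the average over the
      index is meaningful.\<close>
    ultimately have T_pos: "real T > 0" by linarith
    have S: "S / real T \<le> \<epsilon>"
      using sum_expected_gradient
      by (intro mean_gradient_le[OF \<epsilon> L(1) rho_pos G _ T_pos \<epsilon>1 \<delta>_def b_ge T_ge])
        (auto simp: S_def gap_def intro!: sum_nonneg)
    \<comment> \<open>The index is independent of the whole sample tuple, so each gradient norm is
      expressed through \<open>past T\<close> rather than \<open>past t\<close>.\<close>
    have factor: "\<exists>h\<in>borel_measurable (\<Pi>\<^sub>M p\<in>sample_indices T b. D).
        \<forall>\<omega>\<in>space M. norm (gradient F (x t \<omega>)) = h (past T \<omega>)" if t: "t < T" for t
    proof -
      have mono: "sample_indices t b \<subseteq> sample_indices T b" using t by (intro sample_indices_mono) simp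
      obtain \<Phi> where \<Phi>: "\<Phi> \<in> borel_measurable (\<Pi>\<^sub>M p\<in>sample_indices t b. D)"
        and eq: "\<forall>\<omega>\<in>space M. x t \<omega> = \<Phi> (past t \<omega>)"
        using iterate_function_of_past[OF less_imp_le[OF t]] by (rule bexE)
      define h where "h s = norm (gradient F (\<Phi> (restrict s (sample_indices t b))))" for s
      have "h \<in> borel_measurable (\<Pi>\<^sub>M p\<in>sample_indices T b. D)"
        unfolding h_def
        by (intro measurable_compose[OF measurable_compose[OF measurable_compose[OF
              measurable_restrict_subset[OF mono] \<Phi>] gradient_measurable] borel_measurable_norm])
      moreover have "restrict (past T \<omega>) (sample_indices t b) = past t \<omega>" for \<omega>
        using mono by (simp add: restrict_restrict Int_absorb1)
      then have "\<forall>\<omega>\<in>space M. norm (gradient F (x t \<omega>)) = h (past T \<omega>)"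
        using eq by (simp add: h_def)
      ultimately show ?thesis by (intro bexI[of _ h])
    qed
    then obtain h where h: "\<And>t. t < T \<Longrightarrow> h t \<in> borel_measurable (\<Pi>\<^sub>M p\<in>sample_indices T b. D)"
      "\<And>t \<omega>. t < T \<Longrightarrow> \<omega> \<in> space M \<Longrightarrow> norm (gradient F (x t \<omega>)) = h t (past T \<omega>)"
      by metis
    have int: "integrable M (\<lambda>\<omega>. norm (gradient F (x t \<omega>)))" if "t < T" for t
      using that by (intro integrable_continuous_iterate norm_gradient_continuous) simp
    note avg = uniform_index_expectation[where Y = "\<lambda>t \<omega>. norm (gradient F (x t \<omega>))",
        OF unif _ past_measurable[OF order_refl] h int]
    show "integrable M (\<lambda>\<omega>. norm (gradient F (x (\<tau> \<omega>) \<omega>))) \<and>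
        (\<integral>\<omega>. norm (gradient F (x (\<tau> \<omega>) \<omega>)) \<partial>M) \<le> \<epsilon>"
      using avg S T_pos by (simp add: S_def)
  qed
  show "\<exists>C>0. \<forall>\<Delta>F' L0' \<rho>' G0' :: real. \<Delta>F' > 0 \<and> L0' > 0 \<and> \<rho>' > 0 \<and> G0' > 0 \<longrightarrow>
        (\<forall>\<^sub>F \<epsilon> in at_right 0.
           real (card (sample_indices (num_iterations \<Delta>F' L0' \<rho>' \<epsilon>) (batch_size G0' \<epsilon>)))
             \<le> C * (\<Delta>F' * (L0' + \<rho>') * G0'\<^sup>2 / \<epsilon> ^ 4))"
    using sample_complexity by (intro exI[of _ 32768]) auto
qed

end
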